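(* Consider the energy $W:\mathrm{GL}^+(2)\to\mathbb{R}$, $W(F)=\|\operatorname{dev}_2\log U\|^2$ with $U=\sqrt{F^TF}$. The maximal ellipticity domain of $W$ is described by the set $$\mathcal{E}_2=\left\{U\in\mathrm{PSym}(2)\;\Big|\;\|\operatorname{dev}_2\log U\|^2\le\frac12\right\};$$ that is, for $F\in\mathrm{GL}^+(2)$, $W$ is Legendre-Hadamard elliptic at $F$ if and only if $U=\sqrt{F^TF}\in\mathcal{E}_2$.
   Context: $\mathrm{GL}^+(n)=\{X\in\mathbb{R}^{n\times n}\mid\det X>0\}$, and $\mathrm{PSym}(n)$ is the set of symmetric positive definite real $n\times n$ matrices. For $F\in\mathrm{GL}^+(n)$, $U=\sqrt{F^TF}\in\mathrm{PSym}(n)$ is the right stretch tensor, and $\log U$ is the principal (symmetric) matrix logarithm of $U$. For $X\in\mathbb{R}^{n\times n}$, $\operatorname{dev}_nX=X-\frac1n\operatorname{tr}(X)\,\mathbb{1}$, where $\mathbb{1}$ is the identity matrix, and $\|X\|^2=\operatorname{tr}(X^TX)$ is the squared Frobenius norm. A $C^2$ function $W:\mathrm{GL}^+(n)\to\mathbb{R}$ is called Legendre-Hadamard elliptic at $F\in\mathrm{GL}^+(n)$ if $$D_F^2W(F).(\xi\otimes\eta,\xi\otimes\eta)\ge0\quad\text{for all }\xi,\eta\in\mathbb{R}^n,$$ where $D_F^2W(F)$ is the second derivative of $W$ at $F$ (a bilinear form on $\mathbb{R}^{n\times n}$) and $\xi\otimes\eta=\xi\eta^T$. The maximal ellipticity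 domain of $W$ is the set of all $F\in\mathrm{GL}^+(n)$ at which $W$ is Legendre-Hadamard elliptic. A set of stretch tensors $U\in\mathrm{PSym}(n)$ describes a subset of $\mathrm{GL}^+(n)$, namely the set of all $F\in\mathrm{GL}^+(n)$ for which $\sqrt{F^TF}$ belongs to the given set. *)

theory Defs
  imports "HOL-Analysis.Analysis"
begin

definition GLp :: "(real^'n^'n) set"
  where "GLp = {X. det X > 0}"

definition PSym :: "(real^'n^'n) set"
  where "PSym = {P. transpose P = P \<and> (\<forall>x. x \<noteq> 0 \<longrightarrow> x \<bullet> (P *v x) > 0)}"

definition mat_sqrt :: "real^'n^'n \<Rightarrow> real^'n^'n"
  where "mat_sqrt A = (THE S. S \<in> PSym \<and> S ** S = A)"

text \<open>The operations \<open>*\<close> and \<open>^\<close> on \<^typ>\<open>real^'n^'n\<close> act entrywise, so powers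
  with respect to the matrix product are written as iterates of \<open>(**) A\<close>.\<close>

definition mat_exp :: "real^'n^'n \<Rightarrow> real^'n^'n"
  where "mat_exp A = (\<Sum>k. (1 / fact k) *\<^sub>R (((**) A ^^ k) (mat 1)))"

text \<open>The principal logarithm of a positive definite symmetric matrix is its only
  symmetric logarithm; outside \<open>PSym\<close> the value is irrelevant.\<close>

definition mat_log :: "real^'n^'n \<Rightarrow> real^'n^'n"
  where "mat_log U = (THE L. transpose L = L \<and> mat_exp L = U)"

definition right_stretch :: "real^'n^'n \<Rightarrow> real^'n^'n"
  where "right_stretch F = mat_sqrt (transpose F ** F)"

definition dev :: "real^'n^'n \<Rightarrow> real^'n^'n"
  where "dev X = X - (trace X / real CARD('n)) *\<^sub>R mat 1"

definition frob_sq :: "real^'n^'n \<Rightarrow> real"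
  where "frob_sq X = trace (transpose X ** X)"

definition tensor :: "real^'n \<Rightarrow> real^'n \<Rightarrow> real^'n^'n"  (infixl \<open>\<otimes>\<^sub>v\<close> 70)
  where "\<xi> \<otimes>\<^sub>v \<eta> = (\<chi> i j. \<xi> $ i * \<eta> $ j)"

text \<open>Functions on \<open>GLp\<close> are represented by total functions. As \<open>GLp\<close> is open, the
  derivatives at its points do not depend on the values outside.\<close>

definition C2_on :: "'a::real_normed_vector set \<Rightarrow> ('a \<Rightarrow> real) \<Rightarrow> bool"
  where "C2_on S W \<longleftrightarrow>
    (\<exists>(D :: 'a \<Rightarrow> 'a \<Rightarrow>\<^sub>L real) (D2 :: 'a \<Rightarrow> 'a \<Rightarrow>\<^sub>L 'a \<Rightarrow>\<^sub>L real).
       (\<forall>X\<in>S. (W has_derivative blinfun_apply (D X)) (at X)) \<and>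
       (\<forall>X\<in>S. (D has_derivative blinfun_apply (D2 X)) (at X)) \<and>
       continuous_on S D2)"

definition second_derivative :: "('a::real_normed_vector \<Rightarrow> real) \<Rightarrow> 'a \<Rightarrow> 'a \<Rightarrow> 'a \<Rightarrow> real"
  where "second_derivative W F H K =
    frechet_derivative (\<lambda>X. frechet_derivative W (at X) K) (at F) H"

text \<open>Ellipticity is a notion for functions that are twice continuously differentiable on
  all of \<open>GLp\<close>. This requirement is part of the predicate, because \<^const>\<open>frechet_derivative\<close>
  is unspecified where no derivative exists.\<close>

definition LH_elliptic :: "(real^'n^'n \<Rightarrow> real) \<Rightarrow> real^'n^'n \<Rightarrow> bool"
  where "LH_elliptic W F \<longleftrightarrow> C2_on GLp W \<and> F \<in> GLp \<and>
    (\<forall>\<xi> \<eta>. second_derivative W F (\<xi> \<otimes>\<^sub>v \<eta>) (\<xi> \<otimes>\<^sub>v \<eta>) \<ge> 0)"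

definition ellipticity_domain :: "(real^'n^'n \<Rightarrow> real) \<Rightarrow> (real^'n^'n) set"
  where "ellipticity_domain W = {F \<in> GLp. LH_elliptic W F}"

definition described_by :: "(real^'n^'n) set \<Rightarrow> (real^'n^'n) set"
  where "described_by E = {F \<in> GLp. right_stretch F \<in> E}"

definition dev_log_energy :: "real^'n^'n \<Rightarrow> real"
  where "dev_log_energy F = frob_sq (dev (mat_log (right_stretch F)))"

definition E2 :: "(real^2^2) set"
  where "E2 = {U \<in> PSym. frob_sq (dev (mat_log U)) \<le> 1/2}"

end

theory Submission
  imports Defs
begin

text \<open>
  Identify \<open>\<real>\<^sup>2\<close> with \<open>\<complex>\<close> and write \<open>F\<close> as \<open>z \<mapsto> a z + b cnj z\<close>. On \<open>GLp\<close> the singular values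
  are \<open>\<bar>a\<bar> \<plusminus> \<bar>b\<bar>\<close>, so \<open>W = s\<^sup>2 / 2\<close> with \<open>s = ln (\<bar>a\<bar> + \<bar>b\<bar>) - ln (\<bar>a\<bar> - \<bar>b\<bar>)\<close>. Smoothness across \<open>b = 0\<close>
  holds because \<open>W\<close> is an even power series in \<open>\<bar>b\<bar> / \<bar>a\<bar>\<close>. Rank-one directions \<open>H\<close> are those whose two
  parts have equal modulus, and the second derivative of \<open>W\<close> along \<open>H\<close> depends only on that modulus
  and on the projections \<open>x\<close>, \<open>y\<close> of the two parts of \<open>H\<close> onto \<open>a\<close> and \<open>b\<close>. Thus
  ellipticity is the nonnegativity of a quadratic polynomial in \<open>(x, y)\<close> on a square, whose
  value at the critical corner is a positive multiple of \<open>1 - s\<close>. Hence the criterion is \<open>s \<le> 1\<close>,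
  that is, \<open>W \<le> 1/2\<close>.
\<close>

subsection \<open>Twice continuously differentiable functions\<close>

lemma C2_onI:
  fixes W :: "'a::real_normed_vector \<Rightarrow> real" and D :: "'a \<Rightarrow> 'a \<Rightarrow>\<^sub>L real" and D2 :: "'a \<Rightarrow> 'a \<Rightarrow>\<^sub>L 'a \<Rightarrow>\<^sub>L real"
  assumes "\<And>X. X \<in> S \<Longrightarrow> (W has_derivative blinfun_apply (D X)) (at X)"
    and "\<And>X. X \<in> S \<Longrightarrow> (D has_derivative blinfun_apply (D2 X)) (at X)"
    and "continuous_on S D2"
  shows "C2_on S W"
  using assms unfolding C2_on_def by blast

lemma C2_onE:
  fixes W :: "'a::real_normed_vector \<Rightarrow> real"
  assumes "C2_on S W"
  obtains D :: "'a \<Rightarrow> 'a \<Rightarrow>\<^sub>L real" and D2 :: "'a \<Rightarrow> 'a \<Rightarrow>\<^sub>L 'a \<Rightarrow>\<^sub>L real"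
  where "\<And>X. X \<in> S \<Longrightarrow> (W has_derivative blinfun_apply (D X)) (at X)"
    and "\<And>X. X \<in> S \<Longrightarrow> (D has_derivative blinfun_apply (D2 X)) (at X)"
    and "continuous_on S W" "continuous_on S D" "continuous_on S D2"
proof -
  obtain D :: "'a \<Rightarrow> 'a \<Rightarrow>\<^sub>L real" and D2 :: "'a \<Rightarrow> 'a \<Rightarrow>\<^sub>L 'a \<Rightarrow>\<^sub>L real"
    where *: "\<And>X. X \<in> S \<Longrightarrow> (W has_derivative blinfun_apply (D X)) (at X)"
      "\<And>X. X \<in> S \<Longrightarrow> (D has_derivative blinfun_apply (D2 X)) (at X)" "continuous_on S D2"
    using assms unfolding C2_on_def by blast
  moreover have "continuous_on S W" "continuous_on S D"
    using * by (meson has_derivative_continuous continuous_at_imp_continuous_on)+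
  ultimately show ?thesis using that by blast
qed

text \<open>Openness lets agreement on the set transfer the first derivative; the second-order
  condition speaks about \<open>D\<close> alone and is reused unchanged.\<close>

lemma C2_on_cong_open:
  fixes W :: "'a::real_normed_vector \<Rightarrow> real"
  assumes "open S" "\<And>X. X \<in> S \<Longrightarrow> V X = W X" "C2_on S V"
  shows "C2_on S W"
proof -
  obtain D D2 where *: "\<And>X. X \<in> S \<Longrightarrow> (V has_derivative blinfun_apply (D X)) (at X)"
    "\<And>X. X \<in> S \<Longrightarrow> (D has_derivative blinfun_apply (D2 X)) (at X)" "continuous_on S D2"
    using C2_onE[OF assms(3)] by metis
  show ?thesis
  proof (rule C2_onI)
    show "(W has_derivative blinfun_apply (D X)) (at X)" if "X \<in> S" for X
      using has_derivative_transform_within_open[OF *(1)[OF that] assms(1) that] assms(2) by auto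
  qed (use * in auto)
qed

lemma C2_on_const: "C2_on S (\<lambda>_. c)"
  by (rule C2_onI[where D = "\<lambda>_. 0" and ?D2.0 = "\<lambda>_. 0"]) (auto simp: zero_blinfun.rep_eq[abs_def])

lemma C2_on_linear:
  assumes "bounded_linear W"
  shows "C2_on S W"
  by (rule C2_onI[where D = "\<lambda>_. Blinfun W" and ?D2.0 = "\<lambda>_. 0"])
    (auto simp: zero_blinfun.rep_eq[abs_def] bounded_linear_Blinfun_apply assms
      intro: bounded_linear_imp_has_derivative)

lemma C2_on_add:
  assumes "C2_on S V" "C2_on S W"
  shows "C2_on S (\<lambda>X. V X + W X)"
proof -
  obtain D D2 where D: "\<And>X. X \<in> S \<Longrightarrow> (V has_derivative blinfun_apply (D X)) (at X)"
    "\<And>X. X \<in> S \<Longrightarrow> (D has_derivative blinfun_apply (D2 X)) (at X)" "continuous_on S D2"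
    using C2_onE[OF assms(1)] by metis
  obtain E E2 where E: "\<And>X. X \<in> S \<Longrightarrow> (W has_derivative blinfun_apply (E X)) (at X)"
    "\<And>X. X \<in> S \<Longrightarrow> (E has_derivative blinfun_apply (E2 X)) (at X)" "continuous_on S E2"
    using C2_onE[OF assms(2)] by metis
  show ?thesis
    by (rule C2_onI[where D = "\<lambda>X. D X + E X" and ?D2.0 = "\<lambda>X. D2 X + E2 X"])
      (use D E in \<open>auto simp: plus_blinfun.rep_eq[abs_def] intro!: has_derivative_add continuous_intros\<close>)
qed

lemma C2_on_mult:
  fixes V W :: "'a::real_normed_vector \<Rightarrow> real"
  assumes "C2_on S V" "C2_on S W"
  shows "C2_on S (\<lambda>X. V X * W X)"
proof -
  obtain D D2 where D: "\<And>X. X \<in> S \<Longrightarrow> (V has_derivative blinfun_apply (D X)) (at X)"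
    "\<And>X. X \<in> S \<Longrightarrow> (D has_derivative blinfun_apply (D2 X)) (at X)"
    "continuous_on S V" "continuous_on S D" "continuous_on S D2"
    using C2_onE[OF assms(1)] by metis
  obtain E E2 where E: "\<And>X. X \<in> S \<Longrightarrow> (W has_derivative blinfun_apply (E X)) (at X)"
    "\<And>X. X \<in> S \<Longrightarrow> (E has_derivative blinfun_apply (E2 X)) (at X)"
    "continuous_on S W" "continuous_on S E" "continuous_on S E2"
    using C2_onE[OF assms(2)] by metis
  \<comment> \<open>The product rule applied to
    \<open>V X *\<^sub>R E X + W X *\<^sub>R D X\<close>. The term
    \<open>blinfun_scaleR_left (E X) o\<^sub>L D X\<close> is the bilinear form sending
    \<open>H\<close>, \<open>K\<close> to \<open>D X H * E X K\<close>.\<close>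
  define G2 where "G2 X = V X *\<^sub>R E2 X + (blinfun_scaleR_left (E X) o\<^sub>L D X)
      + (W X *\<^sub>R D2 X + (blinfun_scaleR_left (D X) o\<^sub>L E X))" for X
  show ?thesis
  proof (rule C2_onI[where D = "\<lambda>X. V X *\<^sub>R E X + W X *\<^sub>R D X" and ?D2.0 = G2])
    fix X assume X: "X \<in> S"
    show "((\<lambda>X. V X * W X) has_derivative blinfun_apply (V X *\<^sub>R E X + W X *\<^sub>R D X)) (at X)"
      by (rule has_derivative_eq_rhs[OF has_derivative_mult[OF D(1) E(1)]])
        (auto simp: X blinfun.bilinear_simps algebra_simps)
    show "((\<lambda>X. V X *\<^sub>R E X + W X *\<^sub>R D X) has_derivative blinfun_apply (G2 X)) (at X)"
      by (rule has_derivative_eq_rhs[OF has_derivative_add[OF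
              has_derivative_scaleR[OF D(1) E(2)] has_derivative_scaleR[OF E(1) D(2)]]])
        (auto simp: X G2_def blinfun.bilinear_simps algebra_simps)
  next
    show "continuous_on S G2"
      unfolding G2_def using D(3-) E(3-)
      by (intro continuous_intros bounded_bilinear.continuous_on[OF bounded_bilinear_blinfun_compose]
          bounded_linear.continuous_on[OF bounded_linear_blinfun_scaleR_left])
  qed
qed

lemma C2_on_compose:
  fixes f :: "'a::real_normed_vector \<Rightarrow> real" and g g' g'' :: "real \<Rightarrow> real"
  assumes "C2_on S f"
    and g: "\<And>t. t \<in> T \<Longrightarrow> (g has_real_derivative g' t) (at t)"
    and g': "\<And>t. t \<in> T \<Longrightarrow> (g' has_real_derivative g'' t) (at t)"
    and cont: "continuous_on T g''" and img: "\<And>X. X \<in> S \<Longrightarrow> f X \<in> T"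
  shows "C2_on S (\<lambda>X. g (f X))"
proof -
  obtain D D2 where D: "\<And>X. X \<in> S \<Longrightarrow> (f has_derivative blinfun_apply (D X)) (at X)"
    "\<And>X. X \<in> S \<Longrightarrow> (D has_derivative blinfun_apply (D2 X)) (at X)"
    "continuous_on S f" "continuous_on S D" "continuous_on S D2"
    using C2_onE[OF assms(1)] by metis
  define G2 where "G2 X = g' (f X) *\<^sub>R D2 X + g'' (f X) *\<^sub>R (blinfun_scaleR_left (D X) o\<^sub>L D X)" for X
  have c: "continuous_on T g'"
    using g' by (meson DERIV_isCont continuous_at_imp_continuous_on)
  have comp: "((\<lambda>X. h (f X)) has_derivative (\<lambda>H. h' (f X) * D X H)) (at X)"
    if "X \<in> S" "\<And>t. t \<in> T \<Longrightarrow> (h has_real_derivative h' t) (at t)" for X and h h' :: "real \<Rightarrow> real"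
    using has_derivative_compose[OF D(1)[OF that(1)]
        that(2)[OF img[OF that(1)], unfolded has_field_derivative_def]] .
  show ?thesis
  proof (rule C2_onI[where D = "\<lambda>X. g' (f X) *\<^sub>R D X" and ?D2.0 = G2])
    fix X assume X: "X \<in> S"
    show "((\<lambda>X. g (f X)) has_derivative blinfun_apply (g' (f X) *\<^sub>R D X)) (at X)"
      using comp[OF X g] by (simp add: scaleR_blinfun.rep_eq)
    show "((\<lambda>X. g' (f X) *\<^sub>R D X) has_derivative blinfun_apply (G2 X)) (at X)"
      by (rule has_derivative_eq_rhs[OF has_derivative_scaleR[OF comp[OF X g'] D(2)]])
        (auto simp: X G2_def blinfun.bilinear_simps algebra_simps)
  next
    show "continuous_on S G2"
      unfolding G2_def using D(3-) img
      by (intro continuous_intros bounded_bilinear.continuous_on[OF bounded_bilinear_blinfun_compose]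
          bounded_linear.continuous_on[OF bounded_linear_blinfun_scaleR_left]
          continuous_on_compose2[OF cont] continuous_on_compose2[OF c]) auto
  qed
qed

section \<open>Restriction of second derivatives to lines\<close>

text \<open>Reduces \<open>second_derivative\<close>, an iterated Frechet derivative, to calculus in
  one variable. The first derivative of the restriction is claimed only near \<open>0\<close>, since
  the line may leave \<open>S\<close>.\<close>

lemma second_derivative_along_line:
  fixes W :: "'a::real_normed_vector \<Rightarrow> real"
  assumes "C2_on S W" "open S" "F \<in> S"
  obtains f' where "\<forall>\<^sub>F r in nhds 0. ((\<lambda>r. W (F + r *\<^sub>R H)) has_real_derivative f' r) (at r)"
    and "(f' has_real_derivative second_derivative W F H H) (at 0)"
proof -
  obtain D D2 where D: "\<And>X. X \<in> S \<Longrightarrow> (W has_derivative blinfun_apply (D X)) (at X)"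
    "\<And>X. X \<in> S \<Longrightarrow> (D has_derivative blinfun_apply (D2 X)) (at X)"
    using C2_onE[OF assms(1)] by metis
  have line: "((\<lambda>r. F + r *\<^sub>R H) has_derivative (\<lambda>h. h *\<^sub>R H)) (at r)" for r :: real
    by (auto intro!: derivative_eq_intros)
  have DH: "((\<lambda>X. D X H) has_derivative (\<lambda>K. D2 F K H)) (at F)"
    using D(2)[OF assms(3)] by (auto intro!: derivative_eq_intros simp: blinfun.bilinear_simps)
  have fD: "frechet_derivative W (at X) = D X" if "X \<in> S" for X
    using frechet_derivative_at[OF D(1)[OF that]] by simp
  \<comment> \<open>\<open>frechet_derivative W (at X)\<close> equals \<open>D X\<close> on the
    whole open set \<open>S\<close>, hence near \<open>F\<close>, which is what a second
    differentiation requires.\<close>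
  have "((\<lambda>X. frechet_derivative W (at X) H) has_derivative (\<lambda>K. D2 F K H)) (at F)"
    using has_derivative_transform_within_open[OF DH assms(2,3)] by (simp add: fD)
  hence sd: "second_derivative W F H H = D2 F H H"
    unfolding second_derivative_def using frechet_derivative_at by metis
  have "open ((\<lambda>r::real. F + r *\<^sub>R H) -` S)"
    by (intro open_vimage assms continuous_intros)
  hence "\<forall>\<^sub>F r in nhds (0::real). F + r *\<^sub>R H \<in> S"
    using eventually_nhds_in_open[of _ "0::real"] assms(3) by fastforce
  hence "\<forall>\<^sub>F r in nhds 0. ((\<lambda>r. W (F + r *\<^sub>R H)) has_real_derivative D (F + r *\<^sub>R H) H) (at r)"
  proof eventually_elim
    case (elim r)
    show ?case
      using has_derivative_compose[OF line D(1)[OF elim]]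
      by (simp add: has_field_derivative_def blinfun.bilinear_simps mult.commute[of _ "D _ _"])
  qed
  moreover have "((\<lambda>r. D (F + r *\<^sub>R H) H) has_real_derivative second_derivative W F H H) (at 0)"
    using has_derivative_compose[OF line[of 0], of "\<lambda>X. D X H" "\<lambda>K. D2 F K H"] DH
    by (simp add: sd has_field_derivative_def blinfun.bilinear_simps mult.commute[of _ "D2 _ _ _"])
  ultimately show ?thesis by (rule that)
qed

lemma second_derivative_unique_along_line:
  fixes W :: "'a::real_normed_vector \<Rightarrow> real"
  assumes "C2_on S W" "open S" "F \<in> S"
    and eq: "\<forall>\<^sub>F r in nhds 0. W (F + r *\<^sub>R H) = f r"
    and f': "\<forall>\<^sub>F r in nhds 0. (f has_real_derivative f' r) (at r)"
    and f'': "(f' has_real_derivative f'') (at 0)"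
  shows "second_derivative W F H H = f''"
proof -
  obtain g' where g: "\<forall>\<^sub>F r in nhds 0. ((\<lambda>r. W (F + r *\<^sub>R H)) has_real_derivative g' r) (at r)"
    "(g' has_real_derivative second_derivative W F H H) (at 0)"
    using second_derivative_along_line[OF assms(1-3)] by blast
  \<comment> \<open>Derivatives at \<open>r\<close> agree once the functions agree on a
    neighbourhood of \<open>r\<close>, not just at \<open>r\<close>;
    \<open>eventually_eventually\<close> strengthens \<open>eq\<close> to this.\<close>
  have "\<forall>\<^sub>F r in nhds 0. g' r = f' r"
    using g(1) f' eventually_eventually[THEN iffD2, OF eq]
  proof eventually_elim
    case (elim r)
    thus ?case using DERIV_cong_ev[OF refl elim(3) refl] DERIV_unique by blast
  qed
  hence "(f' has_real_derivative second_derivative W F H H) (at 0)"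
    using g(2) DERIV_cong_ev by blast
  thus ?thesis using f'' DERIV_unique by blast
qed

text \<open>Serves the matrices with \<open>aconf F = 0\<close>, where the explicit formula along
  lines would divide by zero. Were the second derivative negative, the first one, zero at the
  minimum, would be negative just to the right, and the mean value theorem would push
  \<open>W\<close> below \<open>W F\<close>.\<close>

lemma second_derivative_nonneg_at_minimum:
  fixes W :: "'a::real_normed_vector \<Rightarrow> real"
  assumes "C2_on S W" "open S" "F \<in> S" and min: "\<And>X. W F \<le> W X"
  shows "second_derivative W F H H \<ge> 0"
proof (rule ccontr)
  assume "\<not> ?thesis"
  hence neg: "second_derivative W F H H < 0" by simp
  let ?f = "\<lambda>r. W (F + r *\<^sub>R H)"
  obtain f' where f: "\<forall>\<^sub>F r in nhds 0. (?f has_real_derivative f' r) (at r)"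
    and f': "(f' has_real_derivative second_derivative W F H H) (at 0)"
    using second_derivative_along_line[OF assms(1-3)] by blast
  obtain e where e: "e > 0" "\<And>r. \<bar>r\<bar> < e \<Longrightarrow> (?f has_real_derivative f' r) (at r)"
    using f by (auto simp: eventually_nhds_metric dist_real_def)
  have "f' 0 = 0"
    using DERIV_local_min[OF e(2)[of 0] e(1)] min e(1) by simp
  then obtain d where d: "d > 0" "\<And>h. h > 0 \<Longrightarrow> h < d \<Longrightarrow> f' h < 0"
    using DERIV_neg_dec_right[OF f' neg] by auto
  define h where "h = min e d / 2"
  have h: "h > 0" "h < e" "h < d" using e(1) d(1) by (auto simp: h_def min_def)
  have "\<exists>z. 0 < z \<and> z < h \<and> ?f h - ?f 0 = (h - 0) * f' z"
    using h by (intro MVT2 e(2)) auto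
  then obtain z where z: "0 < z" "z < h" "?f h - ?f 0 = h * f' z" by auto
  have "h * f' z < 0" using z h d(2)[of z] by (simp add: mult_pos_neg)
  thus False using z(3) min[of "F + h *\<^sub>R H"] by simp
qed

section \<open>The squared logarithmic ratio as a power series\<close>

lemma power_series_C2_on_unit_interval:
  fixes c :: "nat \<Rightarrow> real"
  assumes "\<And>t. \<bar>t\<bar> < 1 \<Longrightarrow> summable (\<lambda>n. c n * t ^ n)"
  obtains p' p'' where "\<And>t. \<bar>t\<bar> < 1 \<Longrightarrow> ((\<lambda>t. \<Sum>n. c n * t ^ n) has_real_derivative p' t) (at t)"
    "\<And>t. \<bar>t\<bar> < 1 \<Longrightarrow> (p' has_real_derivative p'' t) (at t)"
    "continuous_on {-1<..<1} p''"
proof -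
  define P where "P c t = (\<Sum>n. c n * t ^ n)" for c :: "nat \<Rightarrow> real" and t
  have summ: "summable (\<lambda>n. diffs c n * t ^ n)"
    if "\<And>t. \<bar>t\<bar> < 1 \<Longrightarrow> summable (\<lambda>n. c n * t ^ n)" "\<bar>t\<bar> < 1" for c :: "nat \<Rightarrow> real" and t
    using termdiff_converges[of t 1 c] that by simp
  have der: "(P c has_real_derivative P (diffs c) t) (at t)"
    if s: "\<And>t. \<bar>t\<bar> < 1 \<Longrightarrow> summable (\<lambda>n. c n * t ^ n)" and t: "\<bar>t\<bar> < 1" for c :: "nat \<Rightarrow> real" and t
  proof -
    \<comment> \<open>Termwise differentiation needs convergence at a point of larger modulus than
      \<open>t\<close>; the midpoint of \<open>\<bar>t\<bar>\<close> and \<open>1\<close> is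
      one.\<close>
    have "\<bar>(1 + \<bar>t\<bar>) / 2\<bar> < 1" using t by simp
    from s[OF this] show ?thesis
      unfolding P_def by (rule termdiffs_strong) (use t in simp)
  qed
  have s1: "\<And>t. \<bar>t\<bar> < 1 \<Longrightarrow> summable (\<lambda>n. diffs c n * t ^ n)"
    and s2: "\<And>t. \<bar>t\<bar> < 1 \<Longrightarrow> summable (\<lambda>n. diffs (diffs c) n * t ^ n)"
    using summ assms by blast+
  have "continuous_on {-1<..<1} (P (diffs (diffs c)))"
    by (rule continuous_at_imp_continuous_on) (use der[OF s2] DERIV_isCont in force)
  thus ?thesis
    using that[of "P (diffs c)" "P (diffs (diffs c))"] der[OF assms] der[OF s1] unfolding P_def by blast
qed

text \<open>This is twice the inverse hyperbolic tangent series in \<open>q = sqrt t\<close>. It has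
  only odd powers of \<open>q\<close>, so splitting off one factor \<open>q\<close> leaves a power
  series in \<open>t\<close>.\<close>

lemma ln_ratio_series:
  assumes "0 \<le> t" "t < 1"
  shows "summable (\<lambda>n. t ^ n / real (2*n+1))"
    and "ln (1 + sqrt t) - ln (1 - sqrt t) = 2 * sqrt t * (\<Sum>n. t ^ n / real (2*n+1))"
proof -
  have st: "0 \<le> sqrt t" "sqrt t < 1" using assms by auto
  show s: "summable (\<lambda>n. t ^ n / real (2*n+1))"
    by (rule summable_comparison_test'[of "\<lambda>n. t ^ n" 0])
      (use assms in \<open>auto simp: divide_simps mult_le_cancel_left1\<close>)
  \<comment> \<open>Chosen so that \<open>(?x - 1) / (?x + 1)\<close>, the variable of
    \<open>ln_series_quadratic\<close>, becomes \<open>sqrt t\<close>.\<close>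
  let ?x = "(1 + sqrt t) / (1 - sqrt t)"
  have "(?x - 1) / (?x + 1) = sqrt t" using st by (simp add: field_simps)
  moreover have "?x > 0" using st by (intro divide_pos_pos) linarith+
  ultimately have "(\<lambda>n. 2 * sqrt t ^ (2*n+1) / of_nat (2*n+1)) sums ln ?x"
    using ln_series_quadratic[of ?x] by simp
  moreover have "sqrt t ^ (2*n) = t ^ n" for n
    using assms(1) by (simp add: power_mult)
  ultimately have "(\<lambda>n. (2 * sqrt t) * (t ^ n / real (2*n+1))) sums ln ?x"
    by (simp add: mult.assoc)
  moreover have "(\<lambda>n. (2 * sqrt t) * (t ^ n / real (2*n+1))) sums (2 * sqrt t * (\<Sum>n. t ^ n / real (2*n+1)))"
    using s by (intro sums_mult summable_sums)
  ultimately have "ln ?x = 2 * sqrt t * (\<Sum>n. t ^ n / real (2*n+1))"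
    by (rule sums_unique2)
  thus "ln (1 + sqrt t) - ln (1 - sqrt t) = 2 * sqrt t * (\<Sum>n. t ^ n / real (2*n+1))"
    using st by (simp add: ln_div add_pos_nonneg)
qed

text \<open>Squaring \<open>2 * sqrt t * p t\<close> removes the root and gives
  \<open>2 * t * (p t)\<^sup>2\<close> after halving, which makes sense for negative
  \<open>t\<close> too. The extension matters at \<open>t = 0\<close>, where
  \<open>C2_on_compose\<close> asks for two-sided derivatives.\<close>

lemma C2_extension_of_squared_ln_ratio:
  obtains \<phi> \<phi>' \<phi>'' :: "real \<Rightarrow> real"
  where "\<And>t. 0 \<le> t \<Longrightarrow> t < 1 \<Longrightarrow> \<phi> t = (ln (1 + sqrt t) - ln (1 - sqrt t))\<^sup>2 / 2"
    "\<And>t. t \<in> {-1<..<1} \<Longrightarrow> (\<phi> has_real_derivative \<phi>' t) (at t)"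
    "\<And>t. t \<in> {-1<..<1} \<Longrightarrow> (\<phi>' has_real_derivative \<phi>'' t) (at t)"
    "continuous_on {-1<..<1} \<phi>''"
proof -
  define p where "p t = (\<Sum>n. (1 / real (2*n+1)) * t ^ n)" for t
  have "summable (\<lambda>n. (1 / real (2*n+1)) * t ^ n)" if "\<bar>t\<bar> < 1" for t :: real
    by (rule summable_rabs_cancel, use ln_ratio_series(1)[of "\<bar>t\<bar>"] that in \<open>simp add: abs_mult power_abs\<close>)
  then obtain p' p'' where p: "\<And>t. \<bar>t\<bar> < 1 \<Longrightarrow> (p has_real_derivative p' t) (at t)"
    "\<And>t. \<bar>t\<bar> < 1 \<Longrightarrow> (p' has_real_derivative p'' t) (at t)" "continuous_on {-1<..<1} p''"
    using power_series_C2_on_unit_interval[of "\<lambda>n. 1 / real (2*n+1)"] unfolding p_def by blast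
  have cp: "continuous_on {-1<..<1} p" "continuous_on {-1<..<1} p'"
    by (rule continuous_at_imp_continuous_on, use p(1,2) DERIV_isCont in force)+
  show ?thesis
  proof (rule that)
    show "2 * t * (p t)\<^sup>2 = (ln (1 + sqrt t) - ln (1 - sqrt t))\<^sup>2 / 2" if "0 \<le> t" "t < 1" for t
      using that by (simp add: ln_ratio_series(2) p_def power_mult_distrib)
    show "((\<lambda>t. 2 * t * (p t)\<^sup>2) has_real_derivative 2 * (p t)\<^sup>2 + 4 * t * p t * p' t) (at t)"
      if "t \<in> {-1<..<1}" for t
      using that by (auto intro!: derivative_eq_intros p simp: algebra_simps)
    show "((\<lambda>t. 2 * (p t)\<^sup>2 + 4 * t * p t * p' t) has_real_derivative
        8 * p t * p' t + 4 * t * ((p' t)\<^sup>2 + p t * p'' t)) (at t)" if "t \<in> {-1<..<1}" for t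
      using that by (auto intro!: derivative_eq_intros p simp: algebra_simps power2_eq_square)
    show "continuous_on {-1<..<1} (\<lambda>t. 8 * p t * p' t + 4 * t * ((p' t)\<^sup>2 + p t * p'' t))"
      by (intro continuous_intros p cp)
  qed
qed

subsection \<open>Square root and logarithm of symmetric 2 by 2 matrices\<close>

text \<open>The symmetric matrix with eigenvalues \<open>p\<close> and \<open>m\<close> whose eigenvectors are those of the
  reflection matrix with rows \<open>(c, e)\<close> and \<open>(e, -c)\<close>.\<close>

definition eigmat :: "real \<Rightarrow> real \<Rightarrow> real \<Rightarrow> real \<Rightarrow> real^2^2" where
  "eigmat p m c e = ((p + m) / 2) *\<^sub>R mat 1 + ((p - m) / 2) *\<^sub>R vector [vector [c, e], vector [e, - c]]"

lemma eigmat_nth [simp]: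
  "eigmat p m c e $ 1 $ 1 = (p + m) / 2 + (p - m) / 2 * c"
  "eigmat p m c e $ 1 $ 2 = (p - m) / 2 * e"
  "eigmat p m c e $ 2 $ 1 = (p - m) / 2 * e"
  "eigmat p m c e $ 2 $ 2 = (p + m) / 2 - (p - m) / 2 * c"
  by (simp_all add: eigmat_def mat_def)

lemma mat2_eq_iff:
  "(A :: 'a^2^2) = B \<longleftrightarrow> A$1$1 = B$1$1 \<and> A$1$2 = B$1$2 \<and> A$2$1 = B$2$1 \<and> A$2$2 = B$2$2"
  by (auto simp: vec_eq_iff forall_2)

lemma unit_polar_ex:
  fixes u v :: real
  obtains r c e where "r \<ge> 0" "c\<^sup>2 + e\<^sup>2 = 1" "u = r * c" "v = r * e"
proof (cases "u = 0 \<and> v = 0")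
  case True
  thus ?thesis using that[of 0 1 0] by simp
next
  case False
  define r where "r = sqrt (u\<^sup>2 + v\<^sup>2)"
  have "r > 0" using False by (simp add: r_def sum_power2_gt_zero_iff)
  moreover have "r\<^sup>2 = u\<^sup>2 + v\<^sup>2" by (simp add: r_def)
  moreover from calculation have "(u / r)\<^sup>2 + (v / r)\<^sup>2 = 1"
    using False by (simp add: power_divide flip: add_divide_distrib)
  ultimately show ?thesis using that[of r "u / r" "v / r"] by simp
qed

text \<open>The trace-free part of a symmetric matrix is a nonnegative multiple \<open>r\<close> of
  a reflection, so the eigenvalues are half the trace plus or minus \<open>r\<close>.\<close>

lemma symmetric_eigmat_ex:
  assumes "transpose L = (L :: real^2^2)"
  obtains p m c e where "m \<le> p" "c\<^sup>2 + e\<^sup>2 = 1" "L = eigmat p m c e"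
proof -
  obtain r c e where r: "r \<ge> 0" "c\<^sup>2 + e\<^sup>2 = 1" "(L$1$1 - L$2$2) / 2 = r * c" "L$1$2 = r * e"
    by (rule unit_polar_ex)
  have s: "L$2$1 = L$1$2" using arg_cong[OF assms, of "\<lambda>M. M$1$2"] by (simp add: transpose_def)
  let ?t = "(L$1$1 + L$2$2) / 2"
  have "L = eigmat (?t + r) (?t - r) c e"
    unfolding mat2_eq_iff using r(3,4) s by (simp add: field_simps)
  thus ?thesis using that[OF _ r(2), of "?t - r" "?t + r"] r(1) by simp
qed

lemma transpose_eigmat [simp]: "transpose (eigmat p m c e) = eigmat p m c e"
  by (simp add: mat2_eq_iff transpose_def)

text \<open>The reflection squares to the identity, so matrices with common \<open>c\<close>,
  \<open>e\<close> multiply as their eigenvalues do.\<close>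

lemma eigmat_mult:
  assumes "c\<^sup>2 + e\<^sup>2 = 1"
  shows "eigmat p m c e ** eigmat p' m' c e = eigmat (p * p') (m * m') c e"
proof -
  define a b a' b' where ab: "a = (p + m) / 2" "b = (p - m) / 2" "a' = (p' + m') / 2" "b' = (p' - m') / 2"
  have prod: "(p * p' + m * m') / 2 = a * a' + b * b'" "(p * p' - m * m') / 2 = a * b' + b * a'"
    by (simp_all add: ab field_simps)
  have e: "e * e = 1 - c * c" using assms by (simp add: power2_eq_square)
  show ?thesis
    unfolding eigmat_def prod unfolding ab[symmetric]
    by (simp add: mat2_eq_iff matrix_matrix_mult_def sum_2 mat_def algebra_simps e)
qed

text \<open>The trace gives \<open>p + m\<close>, the length of the trace-free part gives
  \<open>(p - m)\<^sup>2\<close>, and the ordering fixes the sign of the root.\<close>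

lemma eigmat_eigenvalues_unique:
  assumes "c\<^sup>2 + e\<^sup>2 = 1" "c'\<^sup>2 + e'\<^sup>2 = 1" "m \<le> p" "m' \<le> p'" "eigmat p m c e = eigmat p' m' c' e'"
  shows "p = p'" "m = m'"
proof -
  have entries: "p + m = S$1$1 + S$2$2" "(p - m) * c = S$1$1 - S$2$2" "(p - m) * e = 2 * S$1$2"
    if "S = eigmat p m c e" for S p m c e
    using that by simp_all
  have eq: "p + m = p' + m'" "(p - m) * c = (p' - m') * c'" "(p - m) * e = (p' - m') * e'"
    using entries[of _ p m c e, OF refl] entries[OF assms(5)] by linarith+
  have "(p - m)\<^sup>2 = (p - m)\<^sup>2 * (c\<^sup>2 + e\<^sup>2)" using assms(1) by simp
  also have "\<dots> = ((p - m) * c)\<^sup>2 + ((p - m) * e)\<^sup>2" by (simp add: distrib_left power_mult_distrib)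
  also have "\<dots> = (p' - m')\<^sup>2 * (c'\<^sup>2 + e'\<^sup>2)" unfolding eq by (simp add: distrib_left power_mult_distrib)
  also have "\<dots> = (p' - m')\<^sup>2" using assms(2) by simp
  finally have "p - m = p' - m'" using assms(3,4) by (simp add: power2_eq_iff_nonneg)
  with eq(1) show "p = p'" "m = m'" by auto
qed

text \<open>The common core of uniqueness for the square root (\<open>f\<close> squaring positive
  reals) and the logarithm (\<open>f = exp\<close>).\<close>

lemma eigmat_map_cancel:
  assumes "c\<^sup>2 + e\<^sup>2 = 1" "c'\<^sup>2 + e'\<^sup>2 = 1" "m \<le> p" "m' \<le> p'"
    and f: "strict_mono_on A f" and A: "{p, m, p', m'} \<subseteq> A"
    and eq: "eigmat (f p) (f m) c e = eigmat (f p') (f m') c' e'"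
  shows "eigmat p m c e = eigmat p' m' c' e'"
proof -
  have "mono_on A f" using f by (rule strict_mono_on_imp_mono_on)
  hence "f m \<le> f p" "f m' \<le> f p'" using A assms(3,4) by (auto simp: monotone_on_def)
  hence "f p = f p'" "f m = f m'" using eigmat_eigenvalues_unique[OF assms(1,2) _ _ eq] by auto
  hence pm: "p = p'" "m = m'"
    using strict_mono_on_imp_inj_on[OF f] A by (auto simp: inj_on_def)
  show ?thesis
  \<comment> \<open>When \<open>p = m\<close> the reflection has coefficient zero: \<open>c\<close>
    and \<open>e\<close> cannot be recovered, but they do not affect the matrix either.\<close>
  proof (cases "p = m")
    case False
    hence "f p \<noteq> f m" using strict_mono_on_imp_inj_on[OF f] A by (auto simp: inj_on_def)
    hence "c = c'" "e = e'" using eq pm by (auto simp: mat2_eq_iff)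
    thus ?thesis using pm by simp
  qed (use pm in \<open>simp add: mat2_eq_iff\<close>)
qed

text \<open>The quadratic form is at least \<open>m\<close> times the squared length, with equality
  at an eigenvector for \<open>m\<close>.\<close>

lemma eigmat_in_PSym_iff:
  assumes "c\<^sup>2 + e\<^sup>2 = 1" "m \<le> p"
  shows "eigmat p m c e \<in> PSym \<longleftrightarrow> m > 0"
proof -
  define Q where "Q x = x \<bullet> (eigmat p m c e *v x)" for x
  have Q: "Q x = (p + m) / 2 * ((x$1)\<^sup>2 + (x$2)\<^sup>2)
      + (p - m) / 2 * (c * ((x$1)\<^sup>2 - (x$2)\<^sup>2) + e * (2 * x$1 * x$2))" for x
    by (simp add: Q_def inner_vec_def matrix_vector_mult_def sum_2 algebra_simps power2_eq_square add_divide_distrib diff_divide_distrib)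
  have sq: "(X\<^sup>2 - Y\<^sup>2)\<^sup>2 + (2 * X * Y)\<^sup>2 = (X\<^sup>2 + Y\<^sup>2)\<^sup>2" for X Y :: real
    by (simp add: power2_eq_square algebra_simps)
  show ?thesis
  proof
    assume "m > 0"
    have "Q x > 0" if "x \<noteq> 0" for x
    proof -
      let ?n = "(x$1)\<^sup>2 + (x$2)\<^sup>2" and ?u = "(x$1)\<^sup>2 - (x$2)\<^sup>2" and ?v = "2 * x$1 * x$2"
      have n: "?n > 0" using that by (auto simp: vec_eq_iff forall_2 sum_power2_gt_zero_iff)
      \<comment> \<open>The Cauchy-Schwarz inequality, with the defect added as a square so that the
        Lagrange identity applies.\<close>
      have "(c * ?u + e * ?v)\<^sup>2 \<le> (c * ?u + e * ?v)\<^sup>2 + (c * ?v - e * ?u)\<^sup>2" by simp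
      also have "\<dots> = (c\<^sup>2 + e\<^sup>2) * (?u\<^sup>2 + ?v\<^sup>2)" by algebra
      also have "\<dots> = ?n\<^sup>2" unfolding assms(1) sq by simp
      finally have "(c * ?u + e * ?v)\<^sup>2 \<le> ?n\<^sup>2" .
      hence "\<bar>c * ?u + e * ?v\<bar> \<le> ?n" using n by (simp add: abs_le_square_iff[symmetric])
      hence "(p - m) / 2 * - ?n \<le> (p - m) / 2 * (c * ?u + e * ?v)"
        using assms(2) by (intro mult_left_mono) auto
      moreover have "(p + m) / 2 * ?n + (p - m) / 2 * - ?n = m * ?n" by (simp add: field_simps)
      moreover have "m * ?n > 0" using n \<open>m > 0\<close> by simp
      ultimately show ?thesis unfolding Q by linarith
    qed
    thus "eigmat p m c e \<in> PSym" by (simp add: PSym_def Q_def)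
  next
    assume psym: "eigmat p m c e \<in> PSym"
    \<comment> \<open>The vector \<open>(e, -(1 + c))\<close> is an eigenvector of the reflection
      for \<open>-1\<close>, but it vanishes when \<open>c = -1\<close>; then \<open>(1, 0)\<close>
      takes its place.\<close>
    obtain x :: "real^2" where x: "x \<noteq> 0" "Q x = m * ((x$1)\<^sup>2 + (x$2)\<^sup>2)"
    proof (cases "c = -1")
      case True
      hence "e = 0" using assms(1) by simp
      have "Q (vector [1, 0]) = m * (((vector [1, 0] :: real^2)$1)\<^sup>2 + ((vector [1, 0]  :: real^2)$2)\<^sup>2)"
        unfolding Q by (simp add: True \<open>e = 0\<close> field_simps)
      moreover have "(vector [1, 0] :: real^2) \<noteq> 0" by (simp add: vec_eq_iff forall_2)
      ultimately show ?thesis using that by blast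
    next
      case False
      define y where "y = (vector [e, - (1 + c)] :: real^2)"
      have y: "y $ 1 = e" "y $ 2 = - (1 + c)" by (simp_all add: y_def)
      have e2: "e\<^sup>2 = 1 - c\<^sup>2" using assms(1) by simp
      have 1: "(y$1)\<^sup>2 + (y$2)\<^sup>2 = 2 * (1 + c)"
        unfolding y power2_minus e2 by (simp add: power2_eq_square algebra_simps)
      have "c * ((y$1)\<^sup>2 - (y$2)\<^sup>2) + e * (2 * y$1 * y$2) = c * (e\<^sup>2 - (1 + c)\<^sup>2) - 2 * e\<^sup>2 * (1 + c)"
        by (simp add: y power2_eq_square algebra_simps)
      also have "\<dots> = - (2 * (1 + c))" unfolding e2 by (simp add: power2_eq_square algebra_simps)
      finally have 2: "c * ((y$1)\<^sup>2 - (y$2)\<^sup>2) + e * (2 * y$1 * y$2) = - (2 * (1 + c))" .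
      have "Q y = m * ((y$1)\<^sup>2 + (y$2)\<^sup>2)" unfolding Q 1 2 by (simp add: field_simps)
      moreover have "y \<noteq> 0" using y(2) False by (auto simp: vec_eq_iff forall_2)
      ultimately show ?thesis using that by blast
    qed
    have "Q x > 0" using psym x(1) by (simp add: PSym_def Q_def)
    thus "m > 0" using x(2) by (smt (verit) mult_nonpos_nonneg sum_power2_ge_zero)
  qed
qed

section \<open>Square root, exponential and logarithm through eigenvalues\<close>

text \<open>For uniqueness, any root in \<open>PSym\<close> is itself an \<open>eigmat\<close> with
  positive eigenvalues, and squaring is strictly increasing on those.\<close>

lemma mat_sqrt_eigmat:
  assumes "c\<^sup>2 + e\<^sup>2 = 1" "0 < m" "m \<le> p"
  shows "mat_sqrt (eigmat (p\<^sup>2) (m\<^sup>2) c e) = eigmat p m c e"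
  unfolding mat_sqrt_def
proof (rule the_equality)
  show "eigmat p m c e \<in> PSym \<and> eigmat p m c e ** eigmat p m c e = eigmat (p\<^sup>2) (m\<^sup>2) c e"
    using assms by (simp add: eigmat_in_PSym_iff eigmat_mult power2_eq_square)
next
  fix S :: "real^2^2"
  assume S: "S \<in> PSym \<and> S ** S = eigmat (p\<^sup>2) (m\<^sup>2) c e"
  hence "transpose S = S" by (simp add: PSym_def)
  then obtain p' m' c' e' where s: "m' \<le> p'" "c'\<^sup>2 + e'\<^sup>2 = 1" "S = eigmat p' m' c' e'"
    by (rule symmetric_eigmat_ex)
  hence "m' > 0" using S eigmat_in_PSym_iff by blast
  show "S = eigmat p m c e"
    unfolding s(3)
  proof (rule eigmat_map_cancel[OF s(2) assms(1) s(1) assms(3), where f = "\<lambda>t. t\<^sup>2" and A = "{0<..}"])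
    show "eigmat (p'\<^sup>2) (m'\<^sup>2) c' e' = eigmat (p\<^sup>2) (m\<^sup>2) c e"
      using S s by (simp add: eigmat_mult power2_eq_square)
  qed (use assms s \<open>m' > 0\<close> in \<open>auto intro!: strict_mono_onI power_strict_mono\<close>)
qed

text \<open>Powers act on the eigenvalues and \<open>eigmat\<close> is linear in them, so the matrix
  series splits into two scalar exponential series.\<close>

lemma mat_exp_eigmat:
  assumes "c\<^sup>2 + e\<^sup>2 = 1"
  shows "mat_exp (eigmat p m c e) = eigmat (exp p) (exp m) c e"
proof -
  have pow: "((**) (eigmat p m c e) ^^ k) (mat 1) = eigmat (p ^ k) (m ^ k) c e" for k
  proof (induction k)
    case 0
    show ?case by (simp add: mat2_eq_iff mat_def)
  qed (use assms in \<open>simp add: eigmat_mult\<close>)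
  let ?a = "\<lambda>k. p ^ k /\<^sub>R fact k" and ?b = "\<lambda>k. m ^ k /\<^sub>R fact k"
  let ?R = "vector [vector [c, e], vector [e, - c]] :: real^2^2"
  have "(\<lambda>k. ((?a k + ?b k) / 2) *\<^sub>R mat 1 + ((?a k - ?b k) / 2) *\<^sub>R ?R) sums eigmat (exp p) (exp m) c e"
    unfolding eigmat_def
    by (intro sums_add sums_diff sums_divide bounded_linear.sums[OF bounded_linear_scaleR_left] exp_converges)
  moreover have "(1 / fact k) *\<^sub>R eigmat (p ^ k) (m ^ k) c e
      = ((?a k + ?b k) / 2) *\<^sub>R mat 1 + ((?a k - ?b k) / 2) *\<^sub>R ?R" for k
    by (simp add: eigmat_def scaleR_add_right divide_simps)
  ultimately show ?thesis
    unfolding mat_exp_def pow by (simp add: sums_iff)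
qed

lemma mat_log_eigmat:
  assumes "c\<^sup>2 + e\<^sup>2 = 1" "0 < m" "m \<le> p"
  shows "mat_log (eigmat p m c e) = eigmat (ln p) (ln m) c e"
  unfolding mat_log_def
proof (rule the_equality)
  show "transpose (eigmat (ln p) (ln m) c e) = eigmat (ln p) (ln m) c e
      \<and> mat_exp (eigmat (ln p) (ln m) c e) = eigmat p m c e"
    using assms by (simp add: mat_exp_eigmat)
next
  fix L :: "real^2^2"
  assume L: "transpose L = L \<and> mat_exp L = eigmat p m c e"
  hence "transpose L = L" by simp
  then obtain p' m' c' e' where s: "m' \<le> p'" "c'\<^sup>2 + e'\<^sup>2 = 1" "L = eigmat p' m' c' e'"
    by (rule symmetric_eigmat_ex)
  show "L = eigmat (ln p) (ln m) c e"
    unfolding s(3)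
  proof (rule eigmat_map_cancel[OF s(2) assms(1) s(1), where f = exp and A = UNIV])
    show "eigmat (exp p') (exp m') c' e' = eigmat (exp (ln p)) (exp (ln m)) c e"
      using L s assms by (simp add: mat_exp_eigmat)
  qed (use assms in \<open>auto intro!: strict_mono_onI\<close>)
qed

text \<open>\<open>dev\<close> removes the multiple of the identity, and the remaining reflection
  has squared Frobenius norm \<open>2\<close>.\<close>

lemma frob_sq_dev_eigmat:
  assumes "c\<^sup>2 + e\<^sup>2 = 1"
  shows "frob_sq (dev (eigmat p m c e)) = (p - m)\<^sup>2 / 2"
proof -
  have "frob_sq (dev (eigmat p m c e)) = (p - m)\<^sup>2 / 2 * (c\<^sup>2 + e\<^sup>2)"
    by (simp add: frob_sq_def dev_def trace_def sum_2 matrix_matrix_mult_def transpose_def mat_def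
        power2_eq_square field_simps)
  thus ?thesis using assms by simp
qed

section \<open>Singular values from the conformal and anticonformal parts\<close>

text \<open>Identify \<open>\<real>\<^sup>2\<close> with \<open>\<complex>\<close>: a real matrix is the map \<open>z \<mapsto> a z + b cnj z\<close>, and the following
  are \<open>\<bar>a\<bar>\<close> and \<open>\<bar>b\<bar>\<close>. On \<open>GLp\<close>, the singular values are \<open>\<bar>a\<bar> + \<bar>b\<bar>\<close> and \<open>\<bar>a\<bar> - \<bar>b\<bar>\<close>.\<close>

definition conf :: "real^2^2 \<Rightarrow> real" where
  "conf F = sqrt ((F$1$1 + F$2$2)\<^sup>2 + (F$2$1 - F$1$2)\<^sup>2) / 2"

definition aconf :: "real^2^2 \<Rightarrow> real" where
  "aconf F = sqrt ((F$1$1 - F$2$2)\<^sup>2 + (F$2$1 + F$1$2)\<^sup>2) / 2"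

lemma conf_power2: "(conf F)\<^sup>2 = ((F$1$1 + F$2$2)\<^sup>2 + (F$2$1 - F$1$2)\<^sup>2) / 4"
  and aconf_power2: "(aconf F)\<^sup>2 = ((F$1$1 - F$2$2)\<^sup>2 + (F$2$1 + F$1$2)\<^sup>2) / 4"
  by (simp_all add: conf_def aconf_def power_divide)

lemma det_conf_aconf: "det F = (conf F)\<^sup>2 - (aconf F)\<^sup>2"
  unfolding conf_power2 aconf_power2 by (simp add: det_2 power2_eq_square field_simps)

lemma conf_nonneg: "conf F \<ge> 0" and aconf_nonneg: "aconf F \<ge> 0"
  by (simp_all add: conf_def aconf_def)

lemma GLp_iff_conf: "F \<in> GLp \<longleftrightarrow> aconf F < conf F"
  using power_mono_iff[OF conf_nonneg aconf_nonneg, of 2 F F]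
  by (simp add: GLp_def det_conf_aconf) linarith

text \<open>\<open>transpose F ** F\<close> has the trace and determinant expected of the squared
  singular values, and these two numbers determine its ordered eigenvalues.\<close>

lemma right_stretch_eigmat:
  assumes "F \<in> GLp"
  obtains c e where "c\<^sup>2 + e\<^sup>2 = 1"
    "right_stretch F = eigmat (conf F + aconf F) (conf F - aconf F) c e"
proof -
  let ?A = "transpose F ** F" and ?p = "conf F + aconf F" and ?m = "conf F - aconf F"
  have pm: "0 < ?m" "?m \<le> ?p" using assms aconf_nonneg[of F] by (auto simp: GLp_iff_conf)
  have "transpose ?A = ?A" by (simp add: matrix_transpose_mul)
  then obtain p m c e where s: "m \<le> p" "c\<^sup>2 + e\<^sup>2 = 1" "?A = eigmat p m c e"
    by (rule symmetric_eigmat_ex)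
  have "p + m = trace (eigmat p m c e)" by (simp add: trace_def sum_2)
  also have "\<dots> = ?p\<^sup>2 + ?m\<^sup>2"
  proof -
    have "?p\<^sup>2 + ?m\<^sup>2 = 2 * (conf F)\<^sup>2 + 2 * (aconf F)\<^sup>2" by (simp add: power2_eq_square algebra_simps)
    thus ?thesis unfolding s(3)[symmetric] conf_power2 aconf_power2
      by (simp add: trace_def sum_2 matrix_matrix_mult_def transpose_def power2_eq_square field_simps)
  qed
  finally have sum: "p + m = ?p\<^sup>2 + ?m\<^sup>2" .
  have "p * m = ((p + m) / 2)\<^sup>2 - ((p - m) / 2)\<^sup>2 * (c\<^sup>2 + e\<^sup>2)"
    unfolding s(2) by (simp add: power2_eq_square field_simps)
  also have "\<dots> = det (eigmat p m c e)" by (simp add: det_2 power2_eq_square field_simps)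
  also have "\<dots> = (det F)\<^sup>2" unfolding s(3)[symmetric] by (simp add: det_mul det_transpose power2_eq_square)
  also have "\<dots> = ?p\<^sup>2 * ?m\<^sup>2" unfolding det_conf_aconf by (simp add: power2_eq_square algebra_simps)
  finally have prod: "p * m = ?p\<^sup>2 * ?m\<^sup>2" .
  \<comment> \<open>Sum and product fix the squared difference; both differences are nonnegative, so
    the root is unambiguous.\<close>
  have "(p - m)\<^sup>2 = (p + m)\<^sup>2 - 4 * (p * m)" by (simp add: power2_eq_square algebra_simps)
  also have "\<dots> = (?p\<^sup>2 - ?m\<^sup>2)\<^sup>2" unfolding sum prod by (simp add: power2_eq_square algebra_simps)
  finally have "p - m = ?p\<^sup>2 - ?m\<^sup>2"
    using s(1) pm power_mono[OF pm(2), of 2] by (simp add: power2_eq_iff_nonneg)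
  with sum have "p = ?p\<^sup>2" "m = ?m\<^sup>2" by linarith+
  hence "right_stretch F = eigmat ?p ?m c e"
    unfolding right_stretch_def s(3) using mat_sqrt_eigmat[OF s(2) pm] by simp
  thus ?thesis using that s(2) by blast
qed

lemma right_stretch_in_PSym:
  assumes "F \<in> GLp"
  shows "right_stretch F \<in> (PSym :: (real^2^2) set)"
proof -
  obtain c e where "c\<^sup>2 + e\<^sup>2 = 1"
    "right_stretch F = eigmat (conf F + aconf F) (conf F - aconf F) c e"
    using right_stretch_eigmat[OF assms] .
  thus ?thesis using assms aconf_nonneg[of F] by (simp add: eigmat_in_PSym_iff GLp_iff_conf)
qed

lemma dev_log_energy_eq:
  assumes "F \<in> GLp"
  shows "dev_log_energy F = (ln (conf F + aconf F) - ln (conf F - aconf F))\<^sup>2 / 2"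
proof -
  obtain c e where ce: "c\<^sup>2 + e\<^sup>2 = 1"
    and U: "right_stretch F = eigmat (conf F + aconf F) (conf F - aconf F) c e"
    using right_stretch_eigmat[OF assms] .
  have pos: "0 < conf F - aconf F" "conf F - aconf F \<le> conf F + aconf F"
    using assms aconf_nonneg[of F] by (auto simp: GLp_iff_conf)
  show ?thesis
    unfolding dev_log_energy_def U mat_log_eigmat[OF ce pos] by (rule frob_sq_dev_eigmat[OF ce])
qed

subsection \<open>The ellipticity inequality\<close>

text \<open>For \<open>y\<close> nonzero and \<open>t = \<bar>x\<bar> / \<bar>y\<bar>\<close> in
  \<open>[0, 1]\<close>, the polynomial \<open>a * t^2 - b * t + c\<close> is nonincreasing, because
  its derivative is affine in \<open>t\<close> and nonpositive at both ends. Its minimum is thus the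
  corner value \<open>a - b + c\<close>.\<close>

lemma quadratic_form_nonneg_on_sector:
  fixes a b c x y :: real
  assumes "a - b + c \<ge> 0" "2 * a \<le> b" "0 \<le> b" "\<bar>x\<bar> \<le> \<bar>y\<bar>"
  shows "a * x\<^sup>2 - b * (x * y) + c * y\<^sup>2 \<ge> 0"
proof -
  have "a * (\<bar>x\<bar> + \<bar>y\<bar>) \<le> b * \<bar>y\<bar>"
  proof (cases "a \<ge> 0")
    case True
    have "a * (\<bar>x\<bar> + \<bar>y\<bar>) \<le> a * (2 * \<bar>y\<bar>)" using True assms(4) by (intro mult_left_mono) auto
    also have "\<dots> = (2 * a) * \<bar>y\<bar>" by simp
    also have "\<dots> \<le> b * \<bar>y\<bar>" by (intro mult_right_mono assms(2)) auto
    finally show ?thesis .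
  next
    case False
    hence "a * (\<bar>x\<bar> + \<bar>y\<bar>) \<le> 0" by (simp add: mult_nonpos_nonneg)
    also have "0 \<le> b * \<bar>y\<bar>" using assms(3) by simp
    finally show ?thesis .
  qed
  hence "0 \<le> (\<bar>y\<bar> - \<bar>x\<bar>) * (b * \<bar>y\<bar> - a * (\<bar>x\<bar> + \<bar>y\<bar>))"
    using assms(4) by (intro mult_nonneg_nonneg) auto
  hence "0 \<le> (\<bar>y\<bar> - \<bar>x\<bar>) * (b * \<bar>y\<bar> - a * (\<bar>x\<bar> + \<bar>y\<bar>)) + (a - b + c) * y\<^sup>2"
    using mult_nonneg_nonneg[OF assms(1) zero_le_power2[of y]] by linarith
  also have "\<dots> = a * x\<^sup>2 - b * (\<bar>x\<bar> * \<bar>y\<bar>) + c * y\<^sup>2"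
    by (simp add: algebra_simps power2_eq_square)
  also have "\<dots> \<le> a * x\<^sup>2 - b * (x * y) + c * y\<^sup>2"
    using mult_left_mono[OF abs_ge_self[of "x * y"] assms(3)] by (simp add: abs_mult)
  finally show ?thesis .
qed

text \<open>As \<open>n\<^sup>2\<close> dominates the larger of \<open>x\<^sup>2\<close>, \<open>y\<^sup>2\<close>, it suffices to treat a quadratic form in
  \<open>x\<close>, \<open>y\<close> on each of the sectors \<open>\<bar>x\<bar> \<le> \<bar>y\<bar>\<close> and \<open>\<bar>y\<bar> \<le> \<bar>x\<bar>\<close>; at \<open>x = y = n = 1\<close> its value
  is \<open>4 z\<^sup>2 (1 - z\<^sup>2) (1 - s)\<close>.\<close>

lemma ellipticity_inequality:
  fixes z s x y n :: real
  assumes z: "z = exp (- s)" and s: "0 \<le> s" "s \<le> 1" and xy: "\<bar>x\<bar> \<le> n" "\<bar>y\<bar> \<le> n"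
  shows "(1 - z\<^sup>2) * ((1 + z) * y - (1 - z) * x)\<^sup>2
    + s * (8 * z\<^sup>2 * (n\<^sup>2 - x\<^sup>2 - y\<^sup>2) + (1 + z\<^sup>2) * ((1 + z) * x - (1 - z) * y)\<^sup>2) \<ge> 0" (is "?G \<ge> 0")
proof -
  have z01: "0 < z" "z \<le> 1" using s by (auto simp: z)
  hence z2: "0 \<le> 1 - z\<^sup>2" by (simp add: power_le_one)
  \<comment> \<open>This bound and the next are \<open>1 + u \<le> exp u\<close> at
    \<open>u = - s\<close> and \<open>u = - (2 * s)\<close>.\<close>
  have zs: "1 - s \<le> z" using exp_ge_add_one_self[of "- s"] by (simp add: z)
  have z2s: "1 - z\<^sup>2 \<le> 2 * s"
    using exp_ge_add_one_self[of "- (2 * s)"] by (simp add: z flip: exp_double)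
  define A where "A = (1 - z\<^sup>2) * (1 - z)\<^sup>2 + s * (1 + z\<^sup>2) * (1 + z)\<^sup>2"
  define B where "B = 2 * (1 - z\<^sup>2)\<^sup>2 + 2 * s * (1 + z\<^sup>2) * (1 - z\<^sup>2)"
  define C where "C = (1 - z\<^sup>2) * (1 + z)\<^sup>2 + s * (1 + z\<^sup>2) * (1 - z)\<^sup>2"
  have G: "?G = A * x\<^sup>2 - B * (x * y) + C * y\<^sup>2 + 8 * z\<^sup>2 * s * (n\<^sup>2 - x\<^sup>2 - y\<^sup>2)"
    by (simp add: A_def B_def C_def power2_eq_square algebra_simps)
  have B0: "B \<ge> 0" unfolding B_def using s z2 by (intro add_nonneg_nonneg mult_nonneg_nonneg) auto
  have "A - B + C - 8 * z\<^sup>2 * s = 4 * z\<^sup>2 * ((1 - z\<^sup>2) * (1 - s))"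
    by (simp add: A_def B_def C_def power2_eq_square algebra_simps)
  also have "\<dots> \<ge> 0" using s z2 by (intro mult_nonneg_nonneg) auto
  finally have ABC: "A - B + C - 8 * z\<^sup>2 * s \<ge> 0" .
  consider "\<bar>x\<bar> \<le> \<bar>y\<bar>" | "\<bar>y\<bar> \<le> \<bar>x\<bar>" by linarith
  thus ?thesis
  proof cases
    case 1
    \<comment> \<open>Here \<open>n\<^sup>2\<close> is lowered to \<open>y\<^sup>2\<close>, which
      turns the coefficient of \<open>x\<^sup>2\<close> into \<open>A - 8 * z\<^sup>2 * s\<close>.
      The chain checks that twice this is at most \<open>B\<close>, as monotonicity on the sector
      demands.\<close>
    have "s * (1 - 2 * z - z\<^sup>2) \<le> s * (1 - z\<^sup>2)" using s z01 by (intro mult_left_mono) auto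
    also have "\<dots> \<le> 1 * (1 - z\<^sup>2)" using s z2 by (intro mult_right_mono) auto
    finally have "0 \<le> 4 * z * ((1 - z) * (1 * (1 - z\<^sup>2) - s * (1 - 2 * z - z\<^sup>2)))"
      using z01 by (intro mult_nonneg_nonneg) auto
    also have "\<dots> = B - 2 * (A - 8 * z\<^sup>2 * s)"
      by (simp add: A_def B_def power2_eq_square algebra_simps)
    finally have "0 \<le> (A - 8 * z\<^sup>2 * s) * x\<^sup>2 - B * (x * y) + C * y\<^sup>2"
      using ABC B0 1 by (intro quadratic_form_nonneg_on_sector) auto
    moreover have "y\<^sup>2 \<le> n\<^sup>2" using xy(2) by (metis abs_le_square_iff abs_of_nonneg abs_ge_zero order_trans)
    hence "0 \<le> 8 * z\<^sup>2 * s * (n\<^sup>2 - y\<^sup>2)" using s by auto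
    ultimately show ?thesis unfolding G by (simp add: algebra_simps)
  next
    case 2
    \<comment> \<open>With the roles exchanged, \<open>2 * (C - 8 * z\<^sup>2 * s) \<le> B\<close>
      is needed; this is where the exponential bounds enter.\<close>
    have "(1 - s) * (1 - z\<^sup>2) \<le> z * (1 - z\<^sup>2)" using zs z2 by (intro mult_right_mono)
    also have "\<dots> \<le> z * (2 * s)" using z2s z01 by (intro mult_left_mono) auto
    finally have "0 \<le> 4 * z * ((1 + z) * (z * (2 * s) - (1 - s) * (1 - z\<^sup>2)))"
      using z01 by (intro mult_nonneg_nonneg) auto
    also have "\<dots> = B - 2 * (C - 8 * z\<^sup>2 * s)"
      by (simp add: C_def B_def power2_eq_square algebra_simps)
    finally have "0 \<le> (C - 8 * z\<^sup>2 * s) * y\<^sup>2 - B * (y * x) + A * x\<^sup>2"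
      using ABC B0 2 by (intro quadratic_form_nonneg_on_sector) auto
    moreover have "x\<^sup>2 \<le> n\<^sup>2" using xy(1) by (metis abs_le_square_iff abs_of_nonneg abs_ge_zero order_trans)
    hence "0 \<le> 8 * z\<^sup>2 * s * (n\<^sup>2 - x\<^sup>2)" using s by auto
    ultimately show ?thesis unfolding G by (simp add: algebra_simps)
  qed
qed

subsection \<open>Second derivatives along rank-one lines\<close>

lemma open_GLp2: "open (GLp :: (real^2^2) set)"
  unfolding GLp_def det_2 by (intro open_Collect_less continuous_intros)

text \<open>The energy factors through the squares of \<open>conf\<close> and \<open>aconf\<close>,
  which are polynomial in the entries, and \<open>conf\<close> is positive on \<open>GLp\<close>.
  Hence no smoothness is lost where \<open>aconf\<close> vanishes.\<close>

lemma C2_on_dev_log_energy: "C2_on GLp (dev_log_energy :: real^2^2 \<Rightarrow> real)"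
proof -
  obtain \<phi> \<phi>' \<phi>'' :: "real \<Rightarrow> real"
    where \<phi>: "\<And>t. 0 \<le> t \<Longrightarrow> t < 1 \<Longrightarrow> \<phi> t = (ln (1 + sqrt t) - ln (1 - sqrt t))\<^sup>2 / 2"
      and der: "\<And>t. t \<in> {-1<..<1} \<Longrightarrow> (\<phi> has_real_derivative \<phi>' t) (at t)"
        "\<And>t. t \<in> {-1<..<1} \<Longrightarrow> (\<phi>' has_real_derivative \<phi>'' t) (at t)"
        "continuous_on {-1<..<1} \<phi>''"
    using C2_extension_of_squared_ln_ratio by metis
  have entry: "bounded_linear (\<lambda>X :: real^2^2. X $ i $ j)" for i j
    using bounded_linear_compose[OF bounded_linear_vec_nth bounded_linear_vec_nth] by blast
  have sq: "C2_on GLp (\<lambda>X :: real^2^2. (conf X)\<^sup>2)" "C2_on GLp (\<lambda>X :: real^2^2. (aconf X)\<^sup>2)"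
    unfolding conf_power2 aconf_power2 unfolding power2_eq_square divide_inverse
    by (intro C2_on_mult C2_on_add C2_on_const C2_on_linear bounded_linear_add bounded_linear_sub entry)+
  have inv: "C2_on GLp (\<lambda>X :: real^2^2. 1 / (conf X)\<^sup>2)"
  proof (rule C2_on_compose[OF sq(1), where T = "{0<..}"])
    fix t :: real assume t: "t \<in> {0<..}"
    show "((\<lambda>t. 1 / t) has_real_derivative - 1 / t\<^sup>2) (at t)"
      using t by (auto intro!: derivative_eq_intros simp: power2_eq_square)
    show "((\<lambda>t. - 1 / t\<^sup>2) has_real_derivative 2 / t ^ 3) (at t)"
      using t by (auto intro!: derivative_eq_intros simp: power2_eq_square power3_eq_cube field_simps)
  next
    fix X :: "real^2^2" assume "X \<in> GLp"
    hence "conf X > 0" using aconf_nonneg[of X] by (simp add: GLp_iff_conf)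
    thus "(conf X)\<^sup>2 \<in> {0<..}" by simp
  qed (auto intro!: continuous_intros)
  have ratio: "0 \<le> aconf X / conf X" "aconf X / conf X < 1" "conf X > 0" if "X \<in> GLp" for X
    using that aconf_nonneg[of X] by (auto simp: GLp_iff_conf)
  have comp: "C2_on GLp (\<lambda>X :: real^2^2. \<phi> ((aconf X)\<^sup>2 * (1 / (conf X)\<^sup>2)))"
  proof (rule C2_on_compose[OF C2_on_mult[OF sq(2) inv] der])
    fix X :: "real^2^2" assume X: "X \<in> GLp"
    have "(aconf X / conf X)\<^sup>2 < 1" using ratio[OF X] power_strict_mono[of _ 1 2] by (metis one_power2 pos2)
    moreover have "-1 < (aconf X / conf X)\<^sup>2" by (rule less_le_trans[OF _ zero_le_power2]) simp
    ultimately show "(aconf X)\<^sup>2 * (1 / (conf X)\<^sup>2) \<in> {-1<..<1}" by (simp add: power_divide)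
  qed
  have "\<phi> ((aconf X)\<^sup>2 * (1 / (conf X)\<^sup>2)) = dev_log_energy X" if X: "X \<in> GLp" for X
  proof -
    let ?q = "aconf X / conf X"
    note q = ratio[OF X]
    have "?q\<^sup>2 < 1" using q power_strict_mono[of _ 1 2] by (metis one_power2 pos2)
    hence "\<phi> (?q\<^sup>2) = (ln (1 + ?q) - ln (1 - ?q))\<^sup>2 / 2"
      using \<phi>[OF zero_le_power2, of ?q] unfolding real_sqrt_abs abs_of_nonneg[OF q(1)] by blast
    also have "1 + ?q = (conf X + aconf X) / conf X" using q(3) by (simp add: field_simps)
    also have "1 - ?q = (conf X - aconf X) / conf X" using q(3) by (simp add: field_simps)
    also have "ln ((conf X + aconf X) / conf X) - ln ((conf X - aconf X) / conf X)
        = ln (conf X + aconf X) - ln (conf X - aconf X)"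
    proof -
      have "0 < conf X - aconf X" "0 < conf X + aconf X"
        using X aconf_nonneg[of X] by (auto simp: GLp_iff_conf)
      thus ?thesis using q(3) by (simp add: ln_div)
    qed
    finally show ?thesis using dev_log_energy_eq[OF X] by (simp add: power_divide)
  qed
  thus ?thesis using comp by (rule C2_on_cong_open[OF open_GLp2])
qed

text \<open>Along a rank-one line, \<open>conf\<close> and \<open>aconf\<close> are square roots of quadratic polynomials with
  the same leading coefficient, because \<open>det\<close> is affine there.\<close>

lemma second_derivative_half_squared_ln_ratio:
  fixes a b x y n :: real
  defines "A \<equiv> \<lambda>r. sqrt (a\<^sup>2 + r * (a * x) + r\<^sup>2 * (n\<^sup>2 / 4))"
    and "B \<equiv> \<lambda>r. sqrt (b\<^sup>2 + r * (b * y) + r\<^sup>2 * (n\<^sup>2 / 4))"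
  assumes b: "0 < b" and ba: "b < a"
  obtains f' f'' where
    "\<forall>\<^sub>F r in nhds 0. ((\<lambda>r. (ln (A r + B r) - ln (A r - B r))\<^sup>2 / 2) has_real_derivative f' r) (at r)"
    "(f' has_real_derivative f'') (at 0)"
    "2 * a * b * (a\<^sup>2 - b\<^sup>2)\<^sup>2 * f'' = 2 * a * b * (a * y - b * x)\<^sup>2
      + (ln (a + b) - ln (a - b)) * ((a\<^sup>2 - b\<^sup>2)\<^sup>2 * (n\<^sup>2 - x\<^sup>2 - y\<^sup>2) + (a\<^sup>2 + b\<^sup>2) * (a * x - b * y)\<^sup>2)"
proof -
  define A' where "A' r = (a * x + r * n\<^sup>2 / 2) / (2 * A r)" for r
  define B' where "B' r = (b * y + r * n\<^sup>2 / 2) / (2 * B r)" for r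
  define f' where "f' r = (ln (A r + B r) - ln (A r - B r))
      * ((A' r + B' r) / (A r + B r) - (A' r - B' r) / (A r - B r))" for r
  define s where "s = ln (a + b) - ln (a - b)"
  \<comment> \<open>For \<open>L\<close> the logarithmic ratio, half its square has second
    derivative \<open>L'^2 + L * L''\<close>. The quotients by \<open>4 * a\<close> and
    \<open>4 * b\<close> are the second derivatives of \<open>A\<close> and \<open>B\<close> at
    \<open>0\<close>.\<close>
  define f'' where "f'' = ((x/2 + y/2) / (a + b) - (x/2 - y/2) / (a - b))\<^sup>2
    + s * ((((n\<^sup>2 - x\<^sup>2) / (4 * a) + (n\<^sup>2 - y\<^sup>2) / (4 * b)) * (a + b) - (x/2 + y/2)\<^sup>2) / (a + b)\<^sup>2
         - (((n\<^sup>2 - x\<^sup>2) / (4 * a) - (n\<^sup>2 - y\<^sup>2) / (4 * b)) * (a - b) - (x/2 - y/2)\<^sup>2) / (a - b)\<^sup>2)"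
  have A0: "A 0 = a" "B 0 = b" "A' 0 = x / 2" "B' 0 = y / 2"
    using b ba by (auto simp: A_def B_def A'_def B'_def)
  have dA: "(A has_real_derivative A' r) (at r)" if "a\<^sup>2 + r * (a * x) + r\<^sup>2 * (n\<^sup>2 / 4) > 0" for r
    using that unfolding A_def A'_def
    by (auto intro!: derivative_eq_intros simp: divide_simps)
  have dB: "(B has_real_derivative B' r) (at r)" if "b\<^sup>2 + r * (b * y) + r\<^sup>2 * (n\<^sup>2 / 4) > 0" for r
    using that unfolding B_def B'_def
    by (auto intro!: derivative_eq_intros simp: divide_simps)
  have dA0: "(A has_real_derivative x / 2) (at 0)" "(B has_real_derivative y / 2) (at 0)"
    using dA[of 0] dB[of 0] b ba by (simp_all add: A0)
  have "(A' has_real_derivative (n\<^sup>2 - x\<^sup>2) / (4 * a)) (at 0)"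
    unfolding A'_def using b ba
    by (auto intro!: derivative_eq_intros dA0 simp: A0 field_simps power2_eq_square)
  moreover have "(B' has_real_derivative (n\<^sup>2 - y\<^sup>2) / (4 * b)) (at 0)"
    unfolding B'_def using b
    by (auto intro!: derivative_eq_intros dA0 simp: A0 field_simps power2_eq_square)
  ultimately have f'': "(f' has_real_derivative f'') (at 0)"
    unfolding f'_def f''_def s_def using b ba
    by (auto intro!: derivative_eq_intros dA0 simp: A0 power2_eq_square)
  have pos: "\<forall>\<^sub>F r in nhds 0. g r > 0" if "isCont g 0" "g 0 > 0" for g :: "real \<Rightarrow> real"
    using order_tendstoD(1)[OF that(1)[unfolded isCont_def] that(2)] that(2)
    by (simp add: eventually_nhds_conv_at)
  have "\<forall>\<^sub>F r in nhds 0. a\<^sup>2 + r * (a * x) + r\<^sup>2 * (n\<^sup>2 / 4) > 0"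
    using b ba by (intro pos continuous_intros) auto
  moreover have "\<forall>\<^sub>F r in nhds 0. b\<^sup>2 + r * (b * y) + r\<^sup>2 * (n\<^sup>2 / 4) > 0"
    using b ba by (intro pos continuous_intros) auto
  moreover have "\<forall>\<^sub>F r in nhds 0. A r - B r > 0"
    using b ba A0 dA0 by (intro pos continuous_intros) (auto intro: DERIV_isCont)
  moreover have "\<forall>\<^sub>F r in nhds 0. A r + B r > 0"
    using b ba A0 dA0 by (intro pos continuous_intros) (auto intro: DERIV_isCont)
  ultimately have f': "\<forall>\<^sub>F r in nhds 0.
      ((\<lambda>r. (ln (A r + B r) - ln (A r - B r))\<^sup>2 / 2) has_real_derivative f' r) (at r)"
  proof eventually_elim
    case (elim r)
    note d = dA[OF elim(1)] dB[OF elim(2)]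
    show ?case unfolding f'_def
      by (rule derivative_eq_intros d refl elim(3,4) | simp)+
  qed
  have "2 * a * b * (a\<^sup>2 - b\<^sup>2)\<^sup>2 * f'' = 2 * a * b * (a * y - b * x)\<^sup>2
      + s * ((a\<^sup>2 - b\<^sup>2)\<^sup>2 * (n\<^sup>2 - x\<^sup>2 - y\<^sup>2) + (a\<^sup>2 + b\<^sup>2) * (a * x - b * y)\<^sup>2)"
  proof -
    have d: "(a\<^sup>2 - b\<^sup>2)\<^sup>2 = (a + b)\<^sup>2 * (a - b)\<^sup>2" by (simp add: power2_eq_square algebra_simps)
    have 1: "(a\<^sup>2 - b\<^sup>2)\<^sup>2 * ((x/2 + y/2) / (a + b) - (x/2 - y/2) / (a - b))\<^sup>2 = (a * y - b * x)\<^sup>2"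
    proof -
      have "(x/2 + y/2) / (a + b) - (x/2 - y/2) / (a - b)
          = ((x/2 + y/2) * (a - b) - (x/2 - y/2) * (a + b)) / ((a + b) * (a - b))"
        using b ba by (intro diff_frac_eq) auto
      also have "(x/2 + y/2) * (a - b) - (x/2 - y/2) * (a + b) = a * y - b * x"
        by (simp add: field_simps)
      also have "(a + b) * (a - b) = a\<^sup>2 - b\<^sup>2" by (simp add: power2_eq_square algebra_simps)
      finally have "(x/2 + y/2) / (a + b) - (x/2 - y/2) / (a - b) = (a * y - b * x) / (a\<^sup>2 - b\<^sup>2)" .
      moreover have "a\<^sup>2 - b\<^sup>2 \<noteq> 0" using b ba power_strict_mono[of b a 2] by simp
      ultimately show ?thesis by (simp add: power_divide)
    qed
    \<comment> \<open>With the second derivatives of \<open>A\<close> and \<open>B\<close> named,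
      the identity becomes polynomial once \<open>a + b\<close> and \<open>a - b\<close> are cleared
      from the denominators.\<close>
    define u where "u = (n\<^sup>2 - x\<^sup>2) / (4 * a)"
    define v where "v = (n\<^sup>2 - y\<^sup>2) / (4 * b)"
    have uv: "n\<^sup>2 - x\<^sup>2 = 4 * a * u" "n\<^sup>2 - y\<^sup>2 = 4 * b * v" using b ba by (simp_all add: u_def v_def)
    have 2: "(a\<^sup>2 - b\<^sup>2)\<^sup>2 * (((u + v) * (a + b) - (x/2 + y/2)\<^sup>2) / (a + b)\<^sup>2
        - ((u - v) * (a - b) - (x/2 - y/2)\<^sup>2) / (a - b)\<^sup>2)
      = (a - b)\<^sup>2 * ((u + v) * (a + b) - (x/2 + y/2)\<^sup>2) - (a + b)\<^sup>2 * ((u - v) * (a - b) - (x/2 - y/2)\<^sup>2)"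
      unfolding d using b ba by (simp add: field_simps)
    have 3: "2 * a * b * ((a - b)\<^sup>2 * ((u + v) * (a + b) - (x/2 + y/2)\<^sup>2)
        - (a + b)\<^sup>2 * ((u - v) * (a - b) - (x/2 - y/2)\<^sup>2))
      = (a\<^sup>2 - b\<^sup>2)\<^sup>2 * (n\<^sup>2 - x\<^sup>2 - y\<^sup>2) + (a\<^sup>2 + b\<^sup>2) * (a * x - b * y)\<^sup>2"
    proof -
      have "2 * a * b * ((a - b)\<^sup>2 * ((u + v) * (a + b) - (x/2 + y/2)\<^sup>2)
        - (a + b)\<^sup>2 * ((u - v) * (a - b) - (x/2 - y/2)\<^sup>2))
        = (a\<^sup>2 - b\<^sup>2) * (a\<^sup>2 * (4 * b * v) - b\<^sup>2 * (4 * a * u))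
          - 2 * a * b * ((a - b)\<^sup>2 * (x/2 + y/2)\<^sup>2 - (a + b)\<^sup>2 * (x/2 - y/2)\<^sup>2)"
        by (simp add: power2_eq_square algebra_simps)
      also have "\<dots> = (a\<^sup>2 - b\<^sup>2)\<^sup>2 * (n\<^sup>2 - x\<^sup>2 - y\<^sup>2) + (a\<^sup>2 + b\<^sup>2) * (a * x - b * y)\<^sup>2"
        unfolding uv[symmetric] by (simp add: power2_eq_square field_simps)
      finally show ?thesis .
    qed
    have "2 * a * b * (a\<^sup>2 - b\<^sup>2)\<^sup>2 * f'' = 2 * a * b * ((a\<^sup>2 - b\<^sup>2)\<^sup>2 * ((x/2 + y/2) / (a + b) - (x/2 - y/2) / (a - b))\<^sup>2)
      + s * (2 * a * b * ((a\<^sup>2 - b\<^sup>2)\<^sup>2 * (((u + v) * (a + b) - (x/2 + y/2)\<^sup>2) / (a + b)\<^sup>2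
        - ((u - v) * (a - b) - (x/2 - y/2)\<^sup>2) / (a - b)\<^sup>2)))"
      unfolding f''_def u_def[symmetric] v_def[symmetric] by (simp only: distrib_left mult_ac)
    thus ?thesis unfolding 1 2 3 .
  qed
  thus ?thesis using that[OF f' f''] unfolding s_def by blast
qed

text \<open>The form is homogeneous of degree 4 in \<open>(a, b)\<close>. Scaling by
  \<open>p = a + b\<close> leaves only the ratio \<open>z = (a - b) / p = exp (- s)\<close>, and
  \<open>p ^ 4\<close> times the expression in \<open>ellipticity_inequality\<close> is 8 times the
  form.\<close>

lemma rank_one_form_nonneg:
  fixes a b x y n s :: real
  defines "s \<equiv> ln (a + b) - ln (a - b)"
  assumes ab: "0 \<le> b" "b < a" and s: "s \<le> 1" and xy: "\<bar>x\<bar> \<le> n" "\<bar>y\<bar> \<le> n"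
  shows "2 * a * b * (a * y - b * x)\<^sup>2
    + s * ((a\<^sup>2 - b\<^sup>2)\<^sup>2 * (n\<^sup>2 - x\<^sup>2 - y\<^sup>2) + (a\<^sup>2 + b\<^sup>2) * (a * x - b * y)\<^sup>2) \<ge> 0" (is "?Q \<ge> 0")
proof -
  define p where "p = a + b"
  define z where "z = (a - b) / p"
  have p: "p > 0" using ab by (simp add: p_def)
  have "s \<ge> 0" using ab by (simp add: s_def)
  moreover have "z = exp (- s)" using ab by (simp add: s_def z_def p_def exp_diff)
  ultimately have "0 \<le> p ^ 4 * ((1 - z\<^sup>2) * ((1 + z) * y - (1 - z) * x)\<^sup>2
    + s * (8 * z\<^sup>2 * (n\<^sup>2 - x\<^sup>2 - y\<^sup>2) + (1 + z\<^sup>2) * ((1 + z) * x - (1 - z) * y)\<^sup>2))"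
    using ellipticity_inequality s xy p by (intro mult_nonneg_nonneg) auto
  also have "\<dots> = (p\<^sup>2 - (p * z)\<^sup>2) * ((p + p * z) * y - (p - p * z) * x)\<^sup>2
    + s * (8 * p\<^sup>2 * (p * z)\<^sup>2 * (n\<^sup>2 - x\<^sup>2 - y\<^sup>2) + (p\<^sup>2 + (p * z)\<^sup>2) * ((p + p * z) * x - (p - p * z) * y)\<^sup>2)"
    by (simp add: power2_eq_square power4_eq_xxxx algebra_simps)
  also have "p * z = a - b" using p by (simp add: z_def)
  also have "(p\<^sup>2 - (a - b)\<^sup>2) * ((p + (a - b)) * y - (p - (a - b)) * x)\<^sup>2
    + s * (8 * p\<^sup>2 * (a - b)\<^sup>2 * (n\<^sup>2 - x\<^sup>2 - y\<^sup>2) + (p\<^sup>2 + (a - b)\<^sup>2) * ((p + (a - b)) * x - (p - (a - b)) * y)\<^sup>2)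
    = 8 * ?Q"
    unfolding p_def by (simp add: power2_eq_square algebra_simps)
  finally show ?thesis by simp
qed

section \<open>Conformal and anticonformal parts along a line\<close>

text \<open>\<open>x\<close> is twice the projection of the conformal part of \<open>H\<close> onto
  the direction of that of \<open>F\<close>: it arises as the mixed term of the expanded square, and
  its bound is Cauchy-Schwarz.\<close>

lemma conf_line:
  fixes F H :: "real^2^2"
  assumes "conf F \<noteq> 0"
  defines "x \<equiv> ((F$1$1 + F$2$2) * (H$1$1 + H$2$2) + (F$2$1 - F$1$2) * (H$2$1 - H$1$2)) / (2 * conf F)"
  shows "conf (F + r *\<^sub>R H) = sqrt ((conf F)\<^sup>2 + r * (conf F * x) + r\<^sup>2 * (conf H)\<^sup>2)"
    and "\<bar>x\<bar> \<le> 2 * conf H"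
proof -
  have cx: "conf F * x = ((F$1$1 + F$2$2) * (H$1$1 + H$2$2) + (F$2$1 - F$1$2) * (H$2$1 - H$1$2)) / 2"
    using assms by (simp add: x_def)
  have "(conf (F + r *\<^sub>R H))\<^sup>2 = (conf F)\<^sup>2 + r * (conf F * x) + r\<^sup>2 * (conf H)\<^sup>2"
    unfolding cx conf_power2 by (simp add: power2_eq_square field_simps)
  thus "conf (F + r *\<^sub>R H) = sqrt ((conf F)\<^sup>2 + r * (conf F * x) + r\<^sup>2 * (conf H)\<^sup>2)"
    using conf_nonneg by (metis real_sqrt_unique)
  have "(conf F * x)\<^sup>2 + (((F$1$1 + F$2$2) * (H$2$1 - H$1$2) - (F$2$1 - F$1$2) * (H$1$1 + H$2$2)) / 2)\<^sup>2
      = (conf F)\<^sup>2 * (2 * conf H)\<^sup>2"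
    unfolding cx power_mult_distrib conf_power2 by (simp add: power2_eq_square field_simps)
  hence "(conf F * x)\<^sup>2 \<le> (conf F)\<^sup>2 * (2 * conf H)\<^sup>2"
    by (metis le_add_same_cancel1 zero_le_power2)
  hence "x\<^sup>2 \<le> (2 * conf H)\<^sup>2" using assms(1) by (simp add: power_mult_distrib)
  thus "\<bar>x\<bar> \<le> 2 * conf H" using conf_nonneg[of H] abs_le_square_iff[of x "2 * conf H"] by simp
qed

text \<open>Precomposing with complex conjugation exchanges the two parts, which lets
  \<open>aconf_line\<close> follow from \<open>conf_line\<close>.\<close>

lemma aconf_eq_conf_flip:
  "aconf F = conf (\<chi> i j. if j = 1 then F$i$j else - F$i$j)"
  by (simp add: aconf_def conf_def)

lemma aconf_line:
  fixes F H :: "real^2^2"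
  assumes "aconf F \<noteq> 0"
  defines "y \<equiv> ((F$1$1 - F$2$2) * (H$1$1 - H$2$2) + (F$2$1 + F$1$2) * (H$2$1 + H$1$2)) / (2 * aconf F)"
  shows "aconf (F + r *\<^sub>R H) = sqrt ((aconf F)\<^sup>2 + r * (aconf F * y) + r\<^sup>2 * (aconf H)\<^sup>2)"
    and "\<bar>y\<bar> \<le> 2 * aconf H"
proof -
  let ?T = "\<lambda>F :: real^2^2. (\<chi> i j. if j = 1 then F$i$j else - F$i$j) :: real^2^2"
  have T: "?T (F + r *\<^sub>R H) = ?T F + r *\<^sub>R ?T H" by (simp add: vec_eq_iff)
  show "aconf (F + r *\<^sub>R H) = sqrt ((aconf F)\<^sup>2 + r * (aconf F * y) + r\<^sup>2 * (aconf H)\<^sup>2)"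
    "\<bar>y\<bar> \<le> 2 * aconf H"
    using conf_line(1)[of "?T F" r "?T H"] conf_line(2)[of "?T F" "?T H"] assms(1) unfolding y_def aconf_eq_conf_flip T by simp_all
qed

text \<open>The first row serves as \<open>\<eta>\<close> unless it vanishes, and then the second
  does. Rank-one directions can thus be handled through \<open>det H = 0\<close>.\<close>

lemma rank_one_tensor_ex:
  fixes H :: "real^2^2"
  assumes "det H = 0"
  obtains \<xi> \<eta> where "H = \<xi> \<otimes>\<^sub>v \<eta>"
proof -
  have d: "H$1$1 * H$2$2 = H$1$2 * H$2$1" using assms by (simp add: det_2)
  consider "H$1$1 \<noteq> 0" | "H$1$1 = 0" "H$1$2 \<noteq> 0" | "H$1$1 = 0" "H$1$2 = 0" by blast
  thus ?thesis
  proof cases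
    case 1
    have "H = vector [1, H$2$1 / H$1$1] \<otimes>\<^sub>v H$1"
      unfolding mat2_eq_iff tensor_def using 1 d by (simp add: field_simps)
    thus ?thesis by (rule that)
  next
    case 2
    have "H = vector [1, H$2$2 / H$1$2] \<otimes>\<^sub>v H$1"
      unfolding mat2_eq_iff tensor_def using 2 d by (simp add: field_simps)
    thus ?thesis by (rule that)
  next
    case 3
    have "H = vector [0, 1] \<otimes>\<^sub>v H$2"
      unfolding mat2_eq_iff tensor_def using 3 by simp
    thus ?thesis by (rule that)
  qed
qed

lemma det_tensor2: "det ((\<xi> :: real^2) \<otimes>\<^sub>v \<eta>) = 0"
  by (simp add: det_2 tensor_def)

text \<open>\<open>det H = 0\<close> forces \<open>aconf H = conf H\<close>, so both roots along the
  line have leading coefficient \<open>n\<^sup>2 / 4\<close> with \<open>n = 2 * conf H\<close>, and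
  the one-variable computation applies.\<close>

lemma second_derivative_dev_log_energy:
  fixes F H :: "real^2^2"
  defines "a \<equiv> conf F" and "b \<equiv> aconf F"
  defines "x \<equiv> ((F$1$1 + F$2$2) * (H$1$1 + H$2$2) + (F$2$1 - F$1$2) * (H$2$1 - H$1$2)) / (2 * a)"
    and "y \<equiv> ((F$1$1 - F$2$2) * (H$1$1 - H$2$2) + (F$2$1 + F$1$2) * (H$2$1 + H$1$2)) / (2 * b)"
  assumes F: "F \<in> GLp" and H: "det H = 0" and b: "b > 0"
  shows "2 * a * b * (a\<^sup>2 - b\<^sup>2)\<^sup>2 * second_derivative dev_log_energy F H H
      = 2 * a * b * (a * y - b * x)\<^sup>2 + (ln (a + b) - ln (a - b))
        * ((a\<^sup>2 - b\<^sup>2)\<^sup>2 * ((2 * conf H)\<^sup>2 - x\<^sup>2 - y\<^sup>2) + (a\<^sup>2 + b\<^sup>2) * (a * x - b * y)\<^sup>2)"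
proof -
  have ba: "b < a" using F by (simp add: GLp_iff_conf a_def b_def)
  have Hc: "aconf H = conf H"
    using H conf_nonneg[of H] aconf_nonneg[of H] by (simp add: det_conf_aconf power2_eq_iff_nonneg)
  define n where "n = 2 * conf H"
  have n: "(conf H)\<^sup>2 = n\<^sup>2 / 4" by (simp add: n_def power_mult_distrib)
  have line: "conf (F + r *\<^sub>R H) = sqrt (a\<^sup>2 + r * (a * x) + r\<^sup>2 * (n\<^sup>2 / 4))"
    "aconf (F + r *\<^sub>R H) = sqrt (b\<^sup>2 + r * (b * y) + r\<^sup>2 * (n\<^sup>2 / 4))" for r
    using conf_line(1)[of F r H] aconf_line(1)[of F r H] ba b
    unfolding a_def b_def x_def y_def Hc n by simp_all
  obtain f' f'' where
    f': "\<forall>\<^sub>F r in nhds 0. ((\<lambda>r. (ln (conf (F + r *\<^sub>R H) + aconf (F + r *\<^sub>R H))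
        - ln (conf (F + r *\<^sub>R H) - aconf (F + r *\<^sub>R H)))\<^sup>2 / 2) has_real_derivative f' r) (at r)"
    and f'': "(f' has_real_derivative f'') (at 0)"
    and eq: "2 * a * b * (a\<^sup>2 - b\<^sup>2)\<^sup>2 * f'' = 2 * a * b * (a * y - b * x)\<^sup>2
      + (ln (a + b) - ln (a - b)) * ((a\<^sup>2 - b\<^sup>2)\<^sup>2 * (n\<^sup>2 - x\<^sup>2 - y\<^sup>2) + (a\<^sup>2 + b\<^sup>2) * (a * x - b * y)\<^sup>2)"
    unfolding line by (rule second_derivative_half_squared_ln_ratio[OF b ba])
  have "open ((\<lambda>r::real. F + r *\<^sub>R H) -` GLp)"
    by (intro open_vimage open_GLp2 continuous_intros)
  hence "\<forall>\<^sub>F r in nhds (0::real). F + r *\<^sub>R H \<in> GLp"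
    using eventually_nhds_in_open[of _ "0::real"] F by fastforce
  hence "\<forall>\<^sub>F r in nhds 0. dev_log_energy (F + r *\<^sub>R H) = (ln (conf (F + r *\<^sub>R H) + aconf (F + r *\<^sub>R H))
        - ln (conf (F + r *\<^sub>R H) - aconf (F + r *\<^sub>R H)))\<^sup>2 / 2"
    by eventually_elim (rule dev_log_energy_eq)
  hence "second_derivative dev_log_energy F H H = f''"
    by (rule second_derivative_unique_along_line[OF C2_on_dev_log_energy open_GLp2 F _ f' f''])
  thus ?thesis using eq by (simp add: n_def)
qed

section \<open>The ellipticity criterion\<close>

lemma dev_log_energy_nonneg: "dev_log_energy (F :: real^2^2) \<ge> 0"
  by (simp add: dev_log_energy_def frob_sq_def trace_def matrix_matrix_mult_def transpose_def sum_nonneg)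

lemma LH_elliptic_iff:
  fixes F :: "real^2^2"
  assumes F: "F \<in> GLp"
  defines "s \<equiv> ln (conf F + aconf F) - ln (conf F - aconf F)"
  shows "LH_elliptic dev_log_energy F \<longleftrightarrow> s \<le> 1"
proof -
  define a b where "a = conf F" and "b = aconf F"
  have ab: "0 \<le> b" "b < a" using F aconf_nonneg[of F] by (auto simp: a_def b_def GLp_iff_conf)
  let ?D = "\<lambda>H. second_derivative dev_log_energy F H H"
  note D = second_derivative_dev_log_energy[OF F, folded a_def b_def s_def]
  have ell: "LH_elliptic dev_log_energy F \<longleftrightarrow> (\<forall>H. det H = 0 \<longrightarrow> ?D H \<ge> 0)"
    using F C2_on_dev_log_energy det_tensor2 rank_one_tensor_ex unfolding LH_elliptic_def by metis
  show ?thesis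
  proof (cases "b = 0")
    \<comment> \<open>At a conformal \<open>F\<close> the energy attains its global minimum
      \<open>0\<close> and \<open>s = 0\<close>, so both sides of the equivalence hold.\<close>
    case True
    hence "dev_log_energy F = 0"
      using dev_log_energy_eq[OF F] by (simp add: b_def)
    hence "?D H \<ge> 0" for H
      using second_derivative_nonneg_at_minimum[OF C2_on_dev_log_energy open_GLp2 F] dev_log_energy_nonneg
      by simp
    moreover have "s = 0" using True by (simp add: s_def b_def)
    ultimately show ?thesis unfolding ell by simp
  next
    case False
    hence b: "b > 0" using ab by simp
    have coef: "2 * a * b * (a\<^sup>2 - b\<^sup>2)\<^sup>2 > 0"
      using b ab power_strict_mono[of b a 2] by (intro mult_pos_pos zero_less_power) auto
    show ?thesis
    proof
      assume s: "s \<le> 1"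
      have "?D H \<ge> 0" if H: "det H = 0" for H
      proof -
        have Hc: "aconf H = conf H"
          using H conf_nonneg[of H] aconf_nonneg[of H] by (simp add: det_conf_aconf power2_eq_iff_nonneg)
        have "0 \<le> 2 * a * b * (a\<^sup>2 - b\<^sup>2)\<^sup>2 * ?D H"
          unfolding D[OF H b] unfolding s_def a_def[symmetric] b_def[symmetric]
        proof (rule rank_one_form_nonneg[OF ab])
          show "ln (a + b) - ln (a - b) \<le> 1" using s by (simp add: s_def a_def b_def)
          show "\<bar>((F$1$1 + F$2$2) * (H$1$1 + H$2$2) + (F$2$1 - F$1$2) * (H$2$1 - H$1$2)) / (2 * a)\<bar> \<le> 2 * conf H"
            using conf_line(2)[of F H] ab by (simp add: a_def)
          show "\<bar>((F$1$1 - F$2$2) * (H$1$1 - H$2$2) + (F$2$1 + F$1$2) * (H$2$1 + H$1$2)) / (2 * b)\<bar> \<le> 2 * conf H"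
            using aconf_line(2)[of F H] b by (simp add: b_def Hc)
        qed
        thus ?thesis using coef by (simp add: zero_le_mult_iff)
      qed
      thus "LH_elliptic dev_log_energy F" unfolding ell by blast
    next
      assume "LH_elliptic dev_log_energy F"
      text \<open>The critical direction: the conformal and anticonformal parts of \<open>F\<close>, each normalised.\<close>
      define H :: "real^2^2" where "H = vector [
        vector [((F$1$1 + F$2$2) / a + (F$1$1 - F$2$2) / b) / 2, ((F$2$1 + F$1$2) / b - (F$2$1 - F$1$2) / a) / 2],
        vector [((F$2$1 + F$1$2) / b + (F$2$1 - F$1$2) / a) / 2, ((F$1$1 + F$2$2) / a - (F$1$1 - F$2$2) / b) / 2]]"
      have avg: "(u + v) / 2 + (u - v) / 2 = u" "(u + v) / 2 - (u - v) / 2 = v" for u v :: real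
        by (simp_all add: field_simps)
      have H: "H$1$1 + H$2$2 = (F$1$1 + F$2$2) / a" "H$2$1 - H$1$2 = (F$2$1 - F$1$2) / a"
        "H$1$1 - H$2$2 = (F$1$1 - F$2$2) / b" "H$2$1 + H$1$2 = (F$2$1 + F$1$2) / b"
        by (simp_all only: H_def vector_2 avg)
      have F2: "(F$1$1 + F$2$2)\<^sup>2 + (F$2$1 - F$1$2)\<^sup>2 = 4 * a\<^sup>2" "(F$1$1 - F$2$2)\<^sup>2 + (F$2$1 + F$1$2)\<^sup>2 = 4 * b\<^sup>2"
        using conf_power2[of F] aconf_power2[of F] by (simp_all add: a_def b_def)
      have cH2: "(conf H)\<^sup>2 = 1" "(aconf H)\<^sup>2 = 1"
        unfolding conf_power2 aconf_power2 H power_divide add_divide_distrib[symmetric] F2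
        using b ab by simp_all
      hence cH: "conf H = 1" using conf_nonneg[of H] by (simp add: power2_eq_1_iff)
      have det: "det H = 0" unfolding det_conf_aconf cH2 by simp
      have x: "((F$1$1 + F$2$2) * (H$1$1 + H$2$2) + (F$2$1 - F$1$2) * (H$2$1 - H$1$2)) / (2 * a) = 2"
        unfolding H times_divide_eq_right power2_eq_square[symmetric] add_divide_distrib[symmetric] F2
        using b ab by (simp add: power2_eq_square)
      have y: "((F$1$1 - F$2$2) * (H$1$1 - H$2$2) + (F$2$1 + F$1$2) * (H$2$1 + H$1$2)) / (2 * b) = 2"
        unfolding H times_divide_eq_right power2_eq_square[symmetric] add_divide_distrib[symmetric] F2
        using b by (simp add: power2_eq_square)
      \<comment> \<open>In this direction \<open>x = y = 2 * conf H = 2\<close>, so both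
        Cauchy-Schwarz bounds are attained and the form collapses to a positive multiple of
        \<open>1 - s\<close>.\<close>
      have "0 \<le> 2 * a * b * (a\<^sup>2 - b\<^sup>2)\<^sup>2 * ?D H"
        using \<open>LH_elliptic dev_log_energy F\<close> det coef unfolding ell by (intro mult_nonneg_nonneg[OF less_imp_le]) auto
      also have "\<dots> = 2 * a * b * (a * 2 - b * 2)\<^sup>2
          + s * ((a\<^sup>2 - b\<^sup>2)\<^sup>2 * ((2 * 1)\<^sup>2 - 2\<^sup>2 - 2\<^sup>2) + (a\<^sup>2 + b\<^sup>2) * (a * 2 - b * 2)\<^sup>2)"
        using D[OF det b] unfolding x y cH .
      also have "\<dots> = (8 * a * b * (a - b)\<^sup>2) * (1 - s)"
        by (simp add: power2_eq_square algebra_simps)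
      finally have "0 \<le> (8 * a * b * (a - b)\<^sup>2) * (1 - s)" .
      moreover have "8 * a * b * (a - b)\<^sup>2 > 0" using b ab by simp
      ultimately show "s \<le> 1" by (simp only: zero_le_mult_iff) linarith
    qed
  qed
qed

theorem proposition3p1:
  shows "ellipticity_domain (dev_log_energy :: real^2^2 \<Rightarrow> real) = described_by E2 \<and>
    (\<forall>F\<in>GLp :: (real^2^2) set.
       LH_elliptic dev_log_energy F \<longleftrightarrow> right_stretch F \<in> E2)"
proof -
  have "LH_elliptic dev_log_energy F \<longleftrightarrow> right_stretch F \<in> E2" if F: "F \<in> GLp" for F :: "real^2^2"
  proof -
    define s where "s = ln (conf F + aconf F) - ln (conf F - aconf F)"
    have "s \<ge> 0" using F aconf_nonneg[of F] by (simp add: s_def GLp_iff_conf)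
    \<comment> \<open>The energy is \<open>s\<^sup>2 / 2\<close>, so the threshold
      \<open>1 / 2\<close> on it is the threshold \<open>1\<close> on the nonnegative number
      \<open>s\<close>.\<close>
    have "right_stretch F \<in> E2 \<longleftrightarrow> dev_log_energy F \<le> 1 / 2"
      using right_stretch_in_PSym[OF F] by (simp add: E2_def dev_log_energy_def)
    also have "\<dots> \<longleftrightarrow> s\<^sup>2 \<le> 1" unfolding dev_log_energy_eq[OF F] s_def by simp
    also have "\<dots> \<longleftrightarrow> s \<le> 1" using \<open>s \<ge> 0\<close> by (simp add: abs_square_le_1)
    finally show ?thesis using LH_elliptic_iff[OF F] by (simp add: s_def)
  qed
  thus ?thesis by (auto simp: ellipticity_domain_def described_by_def)
qed

end
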